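(* There exist universal constants $C_0,C_1,K>0$ such that the following holds. Let $t\in\mathbb N$ and $0<\upsilon,\delta,\eta\le 1/2$. Let $\ell_0=\lceil C_1t\log(1/\upsilon)/\delta\rceil$ and $$M_0=C_0\,t\big(t\ell_0+t^3+t\log^*(\ell_0+2)\big).$$ Let $\mu$ be a probability measure on $X=\{0,1\}^{\mathbb Z}$ which is $(M_0,\eta)$-invariant. Then there exist an $M_0$-defined subset $e\subseteq X$ with $\mu(e)\le K\,t^6(\upsilon+\delta+\eta)$ and a partition of $X\setminus e$ into a finite collection $\mathscr T$ of disjoint clopen towers such that: (i) (Complexity upper bound) each tower in $\mathscr T$ is $M_0$-defined; (ii) (Height versus closedness dichotomy) for each tower $\mathrm{Tow}(b,j)$ in $\mathscr T$, either $j<t$ and $\mathrm{Tow}(b,j)$ is $\delta$-closed, or $t\le j<6t+1$; (iii) (Complexity lower bound) for each tower $\mathrm{Tow}(b,j)$ in $\mathscr T$, the set $\pi_{\max(j,t)}(b)$ is a singleton.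
   Context: $\mathbb N=\{1,2,\dots\}$. $X=\{0,1\}^{\mathbb Z}$ carries the product topology, and $L:X\to X$ is the right shift $(Lx)_i=x_{i-1}$. Let $F_n=[-n,n]\cap\mathbb Z$ and let $\pi_n:X\to\{0,1\}^{F_n}$ be restriction of coordinates. For $x\in\{0,1\}^{F_n}$, $\mathrm{Cyl}(x)=\pi_n^{-1}(x)$. A set $b\subseteq X$ is $n$-defined if $b=\pi_n^{-1}(B)$ for some $B\subseteq\{0,1\}^{F_n}$. A Borel probability measure $\mu$ on $X$ is $(M,\eta)$-invariant if $\sum_{x\in\{0,1\}^{F_M}}|\mu(L\,\mathrm{Cyl}(x))-\mu(\mathrm{Cyl}(x))|\le\eta$. A (clopen) tower with base $b$ and height $j\ge1$, denoted $\mathrm{Tow}(b,j)$, is a disjoint union $\bigsqcup_{i=0}^{j-1}L^i b$ with $b\subseteq X$ clopen (so $b,Lb,\dots,L^{j-1}b$ are pairwise disjoint). It is $n$-defined if all of $b,Lb,\dots,L^{j-1}b$ are $n$-defined, and $\delta$-closed if $\mu(L^jb\cap b)\ge(1-\delta)\mu(b)$. $\log^*(N)$ is the iterated logarithm: the number of times $\log$ must be applied iteratively to $N$ to obtain a number at most $2$. Logarithms are to a fixed base, say $2$. *)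

theory Defs
  imports "HOL-Probability.Probability"
begin

text \<open>
  The space \<open>{0,1}\<^sup>\<int>\<close> is the type \<^typ>\<open>int \<Rightarrow> bool\<close>, whose type-class topology is the product of the
  discrete topologies; Borel measures on it have the \<open>\<sigma>\<close>-algebra \<^term>\<open>sets borel\<close>.
  Elements of \<open>{0,1}\<^bsup>F n\<^esup>\<close> are represented as extensional functions.
\<close>

type_synonym config = "int \<Rightarrow> bool"

definition shift :: "config \<Rightarrow> config" where
  "shift x = (\<lambda>i. x (i - 1))"

definition window :: "nat \<Rightarrow> int set" where
  "window n = {- int n..int n}"

definition patterns :: "nat \<Rightarrow> config set" where
  "patterns n = window n \<rightarrow>\<^sub>E UNIV"

definition window_proj :: "nat \<Rightarrow> config \<Rightarrow> config" where
  "window_proj n x = restrict x (window n)"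

definition Cyl :: "nat \<Rightarrow> config \<Rightarrow> config set" where
  "Cyl n x = window_proj n -` {x}"

definition n_defined :: "nat \<Rightarrow> config set \<Rightarrow> bool" where
  "n_defined n b \<longleftrightarrow> (\<exists>B \<subseteq> patterns n. b = window_proj n -` B)"

definition approx_invariant :: "nat \<Rightarrow> real \<Rightarrow> config measure \<Rightarrow> bool" where
  "approx_invariant M \<eta> \<mu> \<longleftrightarrow>
     (\<Sum>x\<in>patterns M. \<bar>measure \<mu> (shift ` Cyl M x) - measure \<mu> (Cyl M x)\<bar>) \<le> \<eta>"

definition Tow :: "config set \<Rightarrow> nat \<Rightarrow> config set" where
  "Tow b j = (\<Union>i<j. (shift ^^ i) ` b)"

definition clopen_tower :: "config set \<Rightarrow> nat \<Rightarrow> bool" where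
  "clopen_tower b j \<longleftrightarrow>
     1 \<le> j \<and> open b \<and> closed b \<and> disjoint_family_on (\<lambda>i. (shift ^^ i) ` b) {..<j}"

definition tower_n_defined :: "nat \<Rightarrow> config set \<Rightarrow> nat \<Rightarrow> bool" where
  "tower_n_defined n b j \<longleftrightarrow> (\<forall>i<j. n_defined n ((shift ^^ i) ` b))"

definition tower_closed :: "config measure \<Rightarrow> real \<Rightarrow> config set \<Rightarrow> nat \<Rightarrow> bool" where
  "tower_closed \<mu> \<delta> b j \<longleftrightarrow>
     measure \<mu> ((shift ^^ j) ` b \<inter> b) \<ge> (1 - \<delta>) * measure \<mu> b"

text \<open>
  A collection of towers is a set of pairs (base, height). The pairwise disjointness is indexed by
  the pairs, so distinct members of the collection cannot give the same nonempty set of points.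
\<close>

definition tower_partition :: "config set \<Rightarrow> (config set \<times> nat) set \<Rightarrow> bool" where
  "tower_partition A \<T> \<longleftrightarrow>
     finite \<T> \<and> (\<forall>(b, j) \<in> \<T>. b \<noteq> {} \<and> clopen_tower b j) \<and>
     disjoint_family_on (\<lambda>(b, j). Tow b j) \<T> \<and> (\<Union>(b, j)\<in>\<T>. Tow b j) = A"

text \<open>
  Minimality guarantees that the logarithm is only ever applied to numbers exceeding 2, so the
  value of \<^term>\<open>log 2\<close> at nonpositive arguments plays no role.
\<close>

definition log_star :: "real \<Rightarrow> nat" where
  "log_star x = (LEAST k. (log 2 ^^ k) x \<le> 2)"

end

theory Submission
  imports Defs
begin

text \<open>
  Write \<open>T\<close> for the shift and think of \<open>T\<^sup>i x\<close> as the state of \<open>x\<close> at time \<open>i\<close>.  Two kinds of towers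
  are needed.  Where \<open>x\<close> looks periodic with a period \<open>p < t\<close> over a long stretch, the only sensible
  tower has height \<open>p\<close>; where it does not, the configurations at nearby times can be told apart,
  and markers at bounded distances can be placed.

  \<^bold>\<open>Periodic stretches.\<close>  Let \<open>z\<close> run over representatives of the shift orbits of configurations of
  least period \<open>p < t\<close>, and let \<open>b\<^sub>k\<close> be the set of those \<open>x\<close> that agree with \<open>z\<close> on \<open>[-2t, 2t + kp]\<close>.
  Then \<open>T\<^sup>p b\<^sub>k \<inter> b\<^sub>k = b\<^bsub>k+1\<^esub>\<close>, so if no \<open>b\<^sub>k\<close> with \<open>k \<le> n\<close> gives a \<open>\<delta>\<close>-closed tower, the measures decay
  geometrically and \<open>\<mu> b\<^sub>n \<le> (1 - \<delta>)\<^sup>n \<mu> b\<^sub>0 \<le> \<upsilon> \<mu> b\<^sub>0\<close> as soon as \<open>n \<ge> log (1/\<upsilon>) / \<delta>\<close>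
  (lemma \<open>exists_stable_scale\<close>).  For every \<open>z\<close> a scale \<open>k \<le> n\<close> is fixed for which one of the two
  alternatives holds.  Two periodic configurations that agree on an interval as long as the sum of
  their periods are equal (lemma \<open>periodic_eqI\<close>, in the spirit of Fine and Wilf), so the towers over
  different \<open>z\<close> are disjoint.  Let \<open>U\<close> be their union.

  \<^bold>\<open>Entries.\<close>  All errors are charged to the set \<open>S\<close> of points that have just entered \<open>U\<close>: the points of a
  base \<open>b\<close> outside \<open>T\<^sup>p b\<close> when the tower is \<open>\<delta>\<close>-closed, and all of \<open>b\<close> when it is not.  In either case
  this has measure at most \<open>(\<upsilon> + \<delta>) \<mu> b\<^sub>0\<close>, and the sets \<open>b\<^sub>0\<close> for different \<open>z\<close> are disjoint, whence
  \<open>\<mu> S \<le> \<upsilon> + \<delta>\<close> however many \<open>z\<close> there are (lemma \<open>measure_entries\<close>).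

  \<^bold>\<open>Aperiodic stretches.\<close>  If \<open>x\<close> and \<open>T\<^sup>i x\<close> with \<open>0 < i < t\<close> agree on a window that contains all the
  intervals above, then \<open>x\<close> looks periodic there and lies in \<open>U\<close>.  Outside \<open>U\<close> the window therefore
  distinguishes any two times less than \<open>t\<close> apart.  Going through its coordinates one after the other
  and deleting, at each coordinate, the points that carry a \<open>1\<close> and have a surviving point
  with a \<open>0\<close> less than \<open>t\<close> away, leaves a set whose points are at least \<open>t\<close> apart; a coordinate moves
  the nearest survivor by less than \<open>t\<close>, so gaps stay proportional to \<open>t\<close> times the window length.
  These markers and the beginnings of aperiodic stretches cut the complement of \<open>U\<close> into pieces that
  are recognised within a bounded radius, and a piece of length at least \<open>t\<close> splits into blocks
  of lengths between \<open>t\<close> and \<open>2t - 1\<close> (lemmas \<open>cut_into_blocks\<close> and \<open>exists_blocks\<close>).  Only pieces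
  shorter than \<open>t\<close> resist, and their points reach \<open>S\<close> in less than \<open>t\<close> steps.

  Hence everything that is not covered lies in the union of the \<open>T\<^sup>i S\<close> with \<open>\<bar>i\<bar> \<le> t\<close>, whose measure is at
  most \<open>(2t + 1) (\<upsilon> + \<delta> + t\<eta>)\<close>.  With \<open>nt \<le> l\<^sub>0\<close> and \<open>4t \<le> l\<^sub>0\<close> the window has radius at most \<open>2l\<^sub>0\<close>, and
  everything is decided by \<open>O(t l\<^sub>0)\<close> coordinates.
\<close>

section \<open>Shifts and finite windows\<close>

definition sh :: "int \<Rightarrow> config \<Rightarrow> config" where
  "sh i x = (\<lambda>j. x (j - i))"

lemma sh_apply: "sh i x j = x (j - i)"
  by (simp add: sh_def)

lemma sh_0 [simp]: "sh 0 x = x"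
  by (simp add: sh_def)

lemma sh_sh [simp]: "sh i (sh k x) = sh (i + k) x"
  by (simp add: sh_def algebra_simps)

lemma shift_pow: "(shift ^^ n) x = sh (int n) x"
proof (induction n)
  case (Suc n)
  then show ?case
    by (simp add: shift_def sh_def algebra_simps)
qed simp

lemma shift_pow_image: "(shift ^^ n) ` b = {y. sh (- int n) y \<in> b}"
proof -
  have "y \<in> (shift ^^ n) ` b" if "sh (- int n) y \<in> b" for y
    using that by (intro image_eqI[where x = "sh (- int n) y"]) (simp_all add: shift_pow)
  then show ?thesis
    by (auto simp: shift_pow)
qed

lemma shift_image: "shift ` b = {y. sh (-1) y \<in> b}"
  using shift_pow_image[of 1 b] by simp

text \<open>
  Locality for functions with arbitrary values: sets are treated as predicates, and distances to
  markers as functions into \<^typ>\<open>nat\<close>.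
\<close>

definition determined :: "nat \<Rightarrow> (config \<Rightarrow> 'a) \<Rightarrow> bool" where
  "determined N f \<longleftrightarrow> (\<forall>x y. (\<forall>j. \<bar>j\<bar> \<le> int N \<longrightarrow> x j = y j) \<longrightarrow> f x = f y)"

lemma determinedI:
  assumes "\<And>x y. (\<And>j. \<bar>j\<bar> \<le> int N \<Longrightarrow> x j = y j) \<Longrightarrow> f x = f y"
  shows "determined N f"
  unfolding determined_def by (intro allI impI assms) simp

lemma determinedD:
  assumes "determined N f" "\<And>j. \<bar>j\<bar> \<le> int N \<Longrightarrow> x j = y j"
  shows "f x = f y"
  using assms(1)[unfolded determined_def, rule_format, of x y] assms(2) by simp

lemma determined_mono:
  assumes "determined N f" "N \<le> M"
  shows "determined M f"
proof (rule determinedI)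
  fix x y :: config
  assume "\<bar>j\<bar> \<le> int M \<Longrightarrow> x j = y j" for j
  then show "f x = f y"
    using assms(2) by (intro determinedD[OF assms(1)]) simp
qed

lemma determined_compose:
  assumes "determined N f"
  shows "determined N (\<lambda>x. F (f x))"
proof (rule determinedI)
  fix x y :: config
  assume "\<bar>j\<bar> \<le> int N \<Longrightarrow> x j = y j" for j
  then have "f x = f y"
    by (rule determinedD[OF assms])
  then show "F (f x) = F (f y)"
    by simp
qed

lemma determined_compose2:
  assumes "determined N f" "determined N g"
  shows "determined N (\<lambda>x. F (f x) (g x))"
proof (rule determinedI)
  fix x y :: config
  assume "\<bar>j\<bar> \<le> int N \<Longrightarrow> x j = y j" for j
  then have "f x = f y \<and> g x = g y"
    by (intro conjI determinedD[OF assms(1)] determinedD[OF assms(2)])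
  then show "F (f x) (g x) = F (f y) (g y)"
    by simp
qed

lemmas determined_conj = determined_compose2[where F = "(\<and>)"]
  and determined_disj = determined_compose2[where F = "(\<or>)"]
  and determined_imp = determined_compose2[where F = "(\<longrightarrow>)"]
  and determined_not = determined_compose[where F = "Not"]

lemma determined_ball:
  assumes "\<And>i. i \<in> I \<Longrightarrow> determined N (P i)"
  shows "determined N (\<lambda>x. \<forall>i\<in>I. P i x)"
proof (rule determinedI)
  fix x y :: config
  assume "\<bar>j\<bar> \<le> int N \<Longrightarrow> x j = y j" for j
  then have "P i x = P i y" if "i \<in> I" for i
    by (rule determinedD[OF assms[OF that]])
  then show "(\<forall>i\<in>I. P i x) = (\<forall>i\<in>I. P i y)"
    by simp
qed

lemma determined_bex:
  assumes "\<And>i. i \<in> I \<Longrightarrow> determined N (P i)"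
  shows "determined N (\<lambda>x. \<exists>i\<in>I. P i x)"
  using determined_not[OF determined_ball[of I N "\<lambda>i x. \<not> P i x"]] determined_not[OF assms]
  by simp

lemma determined_coord: "\<bar>j\<bar> \<le> int N \<Longrightarrow> determined N (\<lambda>x. x j)"
  by (rule determinedI) simp

lemma determined_sh:
  assumes "determined N f" "int N + \<bar>i\<bar> \<le> int M"
  shows "determined M (\<lambda>x. f (sh i x))"
proof (rule determinedI)
  fix x y :: config
  assume "\<bar>j\<bar> \<le> int M \<Longrightarrow> x j = y j" for j
  then show "f (sh i x) = f (sh i y)"
    using assms(2) by (intro determinedD[OF assms(1)]) (simp add: sh_apply)
qed

lemma determined_window_proj: "n \<le> N \<Longrightarrow> determined N (window_proj n)"
proof (rule determinedI)
  fix x y :: config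
  assume "n \<le> N" and agree: "\<bar>j\<bar> \<le> int N \<Longrightarrow> x j = y j" for j
  then show "window_proj n x = window_proj n y"
    unfolding window_proj_def window_def by (intro restrict_ext agree) auto
qed

lemma n_defined_iff: "n_defined N b \<longleftrightarrow> determined N (\<lambda>x. x \<in> b)"
proof
  assume "n_defined N b"
  then obtain B where "b = window_proj N -` B"
    by (auto simp: n_defined_def)
  then show "determined N (\<lambda>x. x \<in> b)"
    using determined_compose[OF determined_window_proj[of N N], of "\<lambda>u. u \<in> B"] by simp
next
  assume det: "determined N (\<lambda>x. x \<in> b)"
  have "y \<in> b" if "x \<in> b" "window_proj N y = window_proj N x" for x y
  proof -
    have "y j = x j" if "\<bar>j\<bar> \<le> int N" for j
      using fun_cong[OF \<open>window_proj N y = window_proj N x\<close>, of j] that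
      by (simp add: window_proj_def window_def restrict_def abs_le_iff)
    then show ?thesis
      using determinedD[OF det] \<open>x \<in> b\<close> by blast
  qed
  then have "b = window_proj N -` (window_proj N ` b)"
    by auto
  moreover have "window_proj N ` b \<subseteq> patterns N"
    by (auto simp: window_proj_def patterns_def)
  ultimately show "n_defined N b"
    unfolding n_defined_def by blast
qed

lemma finite_patterns: "finite (patterns n)"
  unfolding patterns_def window_def by (intro finite_PiE) auto

lemma n_defined_open:
  assumes "n_defined N b"
  shows "open b"
proof -
  have "open {y. \<forall>j\<in>window N. y j = x j}" for x :: config
  proof -
    have "{y. \<forall>j\<in>window N. y j = x j} = (\<Inter>j\<in>window N. (\<lambda>y. y j) -` {x j})"
      by auto
    moreover have "open ((\<lambda>y::config. y j) -` {x j})" for j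
      by (rule open_vimage) (rule discrete_topology_class.open_discrete continuous_on_product_coordinates)+
    moreover have "finite (window N)"
      by (simp add: window_def)
    ultimately show ?thesis
      by (simp add: open_INT)
  qed
  then have "open (\<Union>x\<in>b. {y. \<forall>j\<in>window N. y j = x j})"
    by (intro open_UN) auto
  moreover have "b = (\<Union>x\<in>b. {y. \<forall>j\<in>window N. y j = x j})"
  proof -
    have "y \<in> b" if "x \<in> b" "\<forall>j\<in>window N. y j = x j" for x y
      using determinedD[of N "\<lambda>x. x \<in> b" x y] assms that
      by (auto simp: n_defined_iff window_def abs_le_iff)
    then show ?thesis by auto
  qed
  ultimately show ?thesis
    by (rule back_subst[where P = "open", OF _ sym])
qed

lemma n_defined_Compl: "n_defined N b \<Longrightarrow> n_defined N (- b)"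
  using determined_not[of N "\<lambda>x. x \<in> b"] by (simp add: n_defined_iff)

lemma n_defined_closed: "n_defined N b \<Longrightarrow> closed b"
  unfolding closed_def by (rule n_defined_open) (rule n_defined_Compl)

lemma n_defined_borel: "n_defined N b \<Longrightarrow> b \<in> sets borel"
  by (rule borel_open) (rule n_defined_open)

section \<open>Approximately invariant measures\<close>

text \<open>
  Summing over all cylinders, rather than bounding each of them, makes the error independent of the
  number of cylinders that make up \<open>b\<close>.  This is why errors are always collected into one set first.
\<close>

lemma approx_invariant_shift:
  assumes inv: "approx_invariant M \<eta> \<mu>" and "prob_space \<mu>" and sets: "sets \<mu> = sets borel"
    and b: "n_defined M b"
  shows "\<bar>measure \<mu> (shift ` b) - measure \<mu> b\<bar> \<le> \<eta>"
proof -
  interpret prob_space \<mu> by fact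
  define P where "P = window_proj M ` b"
  have P: "P \<subseteq> patterns M"
    by (auto simp: P_def window_proj_def patterns_def)
  then have "finite P"
    using finite_patterns finite_subset by blast
  have bP: "b = (\<Union>u\<in>P. Cyl M u)"
    using b by (auto simp: n_defined_def P_def Cyl_def)
  have det: "determined M (\<lambda>x. x \<in> Cyl M u)" for u
    using determined_compose[OF determined_window_proj[of M M], of "\<lambda>v. v = u"]
    by (simp add: Cyl_def)
  have "measure \<mu> b = (\<Sum>u\<in>P. measure \<mu> (Cyl M u))"
    unfolding bP
  proof (rule finite_measure_finite_Union)
    show "Cyl M ` P \<subseteq> sets \<mu>"
      using det n_defined_borel by (auto simp: sets n_defined_iff)
    show "disjoint_family_on (Cyl M) P"
      by (auto simp: disjoint_family_on_def Cyl_def)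
  qed fact
  moreover have "measure \<mu> (shift ` b) = (\<Sum>u\<in>P. measure \<mu> (shift ` Cyl M u))"
    unfolding bP image_UN
  proof (rule finite_measure_finite_Union)
    have "determined (M + 1) (\<lambda>x. x \<in> shift ` Cyl M u)" for u
      unfolding shift_image using determined_sh[OF det, of "-1" "M + 1"] by simp
    then show "(\<lambda>u. shift ` Cyl M u) ` P \<subseteq> sets \<mu>"
      using n_defined_borel by (auto simp: sets n_defined_iff)
    show "disjoint_family_on (\<lambda>u. shift ` Cyl M u) P"
      unfolding shift_image by (auto simp: disjoint_family_on_def Cyl_def)
  qed fact
  ultimately have "\<bar>measure \<mu> (shift ` b) - measure \<mu> b\<bar>
      \<le> (\<Sum>u\<in>P. \<bar>measure \<mu> (shift ` Cyl M u) - measure \<mu> (Cyl M u)\<bar>)"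
    by (simp add: sum_subtractf[symmetric] sum_abs)
  also have "\<dots> \<le> (\<Sum>u\<in>patterns M. \<bar>measure \<mu> (shift ` Cyl M u) - measure \<mu> (Cyl M u)\<bar>)"
    using P finite_patterns by (intro sum_mono2) auto
  also have "\<dots> \<le> \<eta>"
    using inv by (simp add: approx_invariant_def)
  finally show ?thesis .
qed

lemma approx_invariant_sh:
  assumes inv: "approx_invariant M \<eta> \<mu>" "prob_space \<mu>" "sets \<mu> = sets borel"
    and b: "n_defined N b" and "int N + \<bar>i\<bar> \<le> int M"
  shows "measure \<mu> {x. sh i x \<in> b} \<le> measure \<mu> b + \<bar>i\<bar> * \<eta>"
proof -
  have def: "n_defined M {x. sh k x \<in> b}" if "\<bar>k\<bar> \<le> \<bar>i\<bar>" for k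
    using determined_sh[of N "\<lambda>x. x \<in> b" k M] b assms(5) that by (simp add: n_defined_iff)
  have step: "\<bar>measure \<mu> {x. sh (k - 1) x \<in> b} - measure \<mu> {x. sh k x \<in> b}\<bar> \<le> \<eta>"
    if "\<bar>k\<bar> \<le> \<bar>i\<bar>" for k
    using approx_invariant_shift[OF inv def[OF that]] by (simp add: shift_image)
  have "int n \<le> \<bar>i\<bar> \<Longrightarrow> measure \<mu> {x. sh (int n) x \<in> b} \<le> measure \<mu> b + real n * \<eta>
      \<and> measure \<mu> {x. sh (- int n) x \<in> b} \<le> measure \<mu> b + real n * \<eta>" for n
  proof (induction n)
    case (Suc n)
    have "- int n - 1 = - int (Suc n)" "int (Suc n) - 1 = int n" "\<bar>int (Suc n)\<bar> \<le> \<bar>i\<bar>" "\<bar>- int n\<bar> \<le> \<bar>i\<bar>"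
      using Suc.prems by simp_all
    with step[of "int (Suc n)"] step[of "- int n"]
    have "\<bar>measure \<mu> {x. sh (int n) x \<in> b} - measure \<mu> {x. sh (int (Suc n)) x \<in> b}\<bar> \<le> \<eta>"
      "\<bar>measure \<mu> {x. sh (- int (Suc n)) x \<in> b} - measure \<mu> {x. sh (- int n) x \<in> b}\<bar> \<le> \<eta>"
      by metis+
    moreover have "real (Suc n) * \<eta> = real n * \<eta> + \<eta>"
      by (simp add: algebra_simps)
    ultimately show ?case
      using Suc by linarith
  qed simp
  from this[of "nat \<bar>i\<bar>"] show ?thesis
    by (cases "i \<ge> 0") auto
qed

section \<open>Sieving a separated set\<close>

text \<open>
  A ruling set computed bit by bit: the listed coordinates are the bits of an identifier of each point
  in time, and in the round of a coordinate the bit \<open>0\<close> wins against the bit \<open>1\<close> among the points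
  that are still present and less than \<open>t\<close> apart.
\<close>

fun sieve :: "nat \<Rightarrow> config set \<Rightarrow> int list \<Rightarrow> config set" where
  "sieve t C [] = C"
| "sieve t C (j # js) = sieve t
     {x \<in> C. \<not> x j \<or> (\<forall>i\<in>{- int t<..<int t}. sh i x \<in> C \<longrightarrow> sh i x j)} js"

lemma sieve_subset: "sieve t C js \<subseteq> C"
  by (induction t C js rule: sieve.induct) auto

text \<open>
  A point deleted in some round has been deleted because of a nearby point that survives this round,
  so each round costs a displacement of less than \<open>t\<close>.
\<close>

lemma sieve_dense:
  "x \<in> C \<Longrightarrow> \<exists>i. \<bar>i\<bar> \<le> int (length js * t) \<and> sh i x \<in> sieve t C js"
proof (induction js arbitrary: C x)
  case (Cons j js)
  define C' where "C' = {x \<in> C. \<not> x j \<or> (\<forall>i\<in>{- int t<..<int t}. sh i x \<in> C \<longrightarrow> sh i x j)}"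
  have "\<exists>k. \<bar>k\<bar> \<le> int t \<and> sh k x \<in> C'"
  proof (cases "x \<in> C'")
    case True
    then show ?thesis by (intro exI[of _ 0]) simp
  next
    case False
    then obtain k where "k \<in> {- int t<..<int t}" "sh k x \<in> C" "\<not> sh k x j"
      using Cons.prems by (auto simp: C'_def)
    then show ?thesis
      by (intro exI[of _ k]) (auto simp: C'_def)
  qed
  then obtain k where k: "\<bar>k\<bar> \<le> int t" "sh k x \<in> C'"
    by blast
  then obtain i where i: "\<bar>i\<bar> \<le> int (length js * t)" "sh i (sh k x) \<in> sieve t C' js"
    using Cons.IH by blast
  have "\<bar>i + k\<bar> \<le> int (length (j # js) * t)"
    using i(1) k(1) abs_triangle_ineq[of i k] by (simp add: algebra_simps)
  then show ?case
    using i(2) by (intro exI[of _ "i + k"]) (simp add: C'_def)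
qed (auto intro: exI[of _ 0])

text \<open>
  If two survivors less than \<open>t\<close> apart differed at \<open>j\<close>, the round of \<open>j\<close> would have deleted one of
  them because of the other.
\<close>

lemma sieve_separated:
  assumes "x \<in> sieve t C js" "sh i x \<in> sieve t C js" "\<bar>i\<bar> < int t" "j \<in> set js"
  shows "x j = sh i x j"
  using assms
proof (induction js arbitrary: C)
  case (Cons k js)
  define C' where "C' = {x \<in> C. \<not> x k \<or> (\<forall>i\<in>{- int t<..<int t}. sh i x \<in> C \<longrightarrow> sh i x k)}"
  have in_sieve: "x \<in> sieve t C' js" "sh i x \<in> sieve t C' js"
    using Cons.prems by (simp_all add: C'_def)
  then have C': "x \<in> C'" "sh i x \<in> C'"
    using sieve_subset by blast+
  show ?case
  proof (cases "j = k")
    case True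
    have "x k \<Longrightarrow> sh i x k"
      using C' Cons.prems(3) unfolding C'_def by force
    moreover have "sh (- i) (sh i x) k" if "sh i x k"
    proof -
      have "sh (- i) (sh i x) \<in> C" "- i \<in> {- int t<..<int t}"
        using C' Cons.prems(3) by (auto simp: C'_def)
      then show ?thesis
        using C'(2) that unfolding C'_def by blast
    qed
    ultimately show ?thesis
      using True by auto
  next
    case False
    then show ?thesis
      using Cons.IH[OF in_sieve] Cons.prems by simp
  qed
qed simp

lemma determined_sieve:
  assumes "determined N (\<lambda>x. x \<in> C)" "\<And>j. j \<in> set js \<Longrightarrow> \<bar>j\<bar> \<le> int N"
  shows "determined (N + length js * t) (\<lambda>x. x \<in> sieve t C js)"
  using assms
proof (induction js arbitrary: C N)
  case (Cons j js)
  have det: "determined (N + t) (\<lambda>x. x \<in> C)"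
    using Cons.prems(1) by (rule determined_mono) simp
  have coord: "determined (N + t) (\<lambda>x. x j)" "determined N (\<lambda>x. x j)"
    using Cons.prems(2)[of j] by (auto intro!: determined_coord)
  have "determined (N + t) (\<lambda>x. x \<in> C \<and>
      (\<not> x j \<or> (\<forall>i\<in>{- int t<..<int t}. sh i x \<in> C \<longrightarrow> sh i x j)))"
    by (intro determined_conj determined_disj determined_not determined_ball determined_imp
        det coord determined_sh[OF Cons.prems(1)] determined_sh[OF coord(2)]) auto
  then have "determined (N + t + length js * t) (\<lambda>x. x \<in> sieve t (C \<inter> {x.
      (\<not> x j \<or> (\<forall>i\<in>{- int t<..<int t}. sh i x \<in> C \<longrightarrow> sh i x j))}) js)"
    using Cons.prems(2) by (intro Cons.IH) force+
  then show ?case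
    by (simp add: Collect_conj_eq algebra_simps)
qed simp

section \<open>Cutting into blocks\<close>

lemma exists_exit:
  assumes "x \<in> A" "sh (int i) x \<notin> A"
  obtains k where "0 < k" "k \<le> i" "sh (int k) x \<notin> A" "sh (int k - 1) x \<in> A"
proof -
  define k where "k = (LEAST k. sh (int k) x \<notin> A)"
  have k: "sh (int k) x \<notin> A" "k \<le> i"
    unfolding k_def using assms(2) by (fact LeastI, fact Least_le)
  then have "0 < k"
    using assms(1) by (cases k) auto
  moreover have "sh (int (k - 1)) x \<in> A"
    using not_less_Least[of "k - 1" "\<lambda>k. sh (int k) x \<notin> A"] \<open>0 < k\<close> by (simp add: k_def)
  ultimately show ?thesis
    using k that by (simp add: of_nat_diff)
qed

text \<open>
  The set \<open>V\<close> contains the cut points: the complement of \<open>A\<close>, the first point of every stretch in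
  \<open>A\<close>, and enough markers to leave no gap longer than \<open>G\<close>.  A piece between consecutive cut points is
  divided at the multiples of \<open>t\<close> counted from its left end, the remainder being added to the last
  block; the base point and the height of a block can thus be read off from the two
  distances to the nearest cut points.  By \<open>spaced\<close> a piece that is too short for even one block is
  followed by an exit from \<open>A\<close>.
\<close>

lemma cut_into_blocks:
  assumes t: "1 \<le> t"
    and det_A: "determined N (\<lambda>x. x \<in> A)" and det_V: "determined N (\<lambda>x. x \<in> V)"
    and outside: "\<And>x. x \<notin> A \<Longrightarrow> x \<in> V"
    and start: "\<And>x. x \<in> A \<Longrightarrow> sh (-1) x \<notin> A \<Longrightarrow> x \<in> V"
    and gap: "\<And>x. \<exists>i\<le>G. sh (int i) x \<in> V"
    and spaced: "\<And>x i. x \<in> V \<Longrightarrow> x \<in> A \<Longrightarrow> 0 < i \<Longrightarrow> i < t \<Longrightarrow> sh (int i) x \<in> V \<Longrightarrow>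
      \<exists>k\<le>i. sh (int k) x \<notin> A"
    and M: "N + G + 1 \<le> M"
  shows "\<exists>B h. determined M (\<lambda>x. x \<in> B) \<and> determined M h \<and>
    (\<forall>x\<in>B. t \<le> h x \<and> h x < 2 * t) \<and>
    (\<forall>x\<in>B. \<forall>i<h x. sh (int i) x \<in> A \<and> (0 < i \<longrightarrow> sh (int i) x \<notin> B)) \<and>
    (\<forall>x\<in>A. (\<exists>y\<in>B. \<exists>i<h y. x = sh (int i) y) \<or>
      (\<exists>k. 0 < k \<and> k < t \<and> sh (int k) x \<notin> A \<and> sh (int k - 1) x \<in> A))"
proof -
  define fwd where "fwd x = (LEAST i. 1 \<le> i \<and> sh (int i) x \<in> V)" for x
  define bwd where "bwd x = (LEAST i. sh (- int i) x \<in> V)" for x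
  have ex_fwd: "\<exists>i\<le>G + 1. 1 \<le> i \<and> sh (int i) x \<in> V" for x
  proof -
    obtain i where "i \<le> G" "sh (int i) (sh 1 x) \<in> V"
      using gap by blast
    then show ?thesis
      by (intro exI[of _ "Suc i"]) (simp add: add.commute)
  qed
  have ex_bwd: "\<exists>i\<le>G. sh (- int i) x \<in> V" for x
  proof -
    obtain i where "i \<le> G" "sh (int i) (sh (- int G) x) \<in> V"
      using gap by blast
    then show ?thesis
      by (intro exI[of _ "G - i"]) (simp add: of_nat_diff)
  qed
  have fwd: "1 \<le> fwd x" "sh (int (fwd x)) x \<in> V" "fwd x \<le> G + 1" for x
  proof -
    obtain i where i: "i \<le> G + 1" "1 \<le> i \<and> sh (int i) x \<in> V"
      using ex_fwd by blast
    show "1 \<le> fwd x" "sh (int (fwd x)) x \<in> V"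
      unfolding fwd_def using LeastI[of "\<lambda>i. 1 \<le> i \<and> sh (int i) x \<in> V", OF i(2)] by blast+
    show "fwd x \<le> G + 1"
      unfolding fwd_def using Least_le[of "\<lambda>i. 1 \<le> i \<and> sh (int i) x \<in> V", OF i(2)] i(1) by simp
  qed
  have bwd: "sh (- int (bwd x)) x \<in> V" "bwd x \<le> G" for x
  proof -
    obtain i where i: "i \<le> G" "sh (- int i) x \<in> V"
      using ex_bwd by blast
    show "sh (- int (bwd x)) x \<in> V"
      unfolding bwd_def by (rule LeastI[of "\<lambda>i. sh (- int i) x \<in> V", OF i(2)])
    show "bwd x \<le> G"
      unfolding bwd_def using Least_le[of "\<lambda>i. sh (- int i) x \<in> V", OF i(2)] i(1) by simp
  qed
  have fwd_min: "sh (int i) x \<notin> V" if "0 < i" "i < fwd x" for x i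
    using not_less_Least[of i "\<lambda>i. 1 \<le> i \<and> sh (int i) x \<in> V"] that by (auto simp: fwd_def)
  have bwd_min: "sh (- int i) x \<notin> V" if "i < bwd x" for x i
    using not_less_Least[of i "\<lambda>i. sh (- int i) x \<in> V"] that by (auto simp: bwd_def)
  have fwd_eqI: "fwd x = k" if "1 \<le> k" "sh (int k) x \<in> V" "\<And>i. 0 < i \<Longrightarrow> i < k \<Longrightarrow> sh (int i) x \<notin> V"
    for x k
    unfolding fwd_def using that by (intro Least_equality) (auto simp: not_less[symmetric])
  have bwd_eqI: "bwd x = k" if "sh (- int k) x \<in> V" "\<And>i. i < k \<Longrightarrow> sh (- int i) x \<notin> V" for x k
    unfolding bwd_def using that by (intro Least_equality) (auto simp: not_less[symmetric])

  \<comment> \<open>Moving forward inside a block, or backward towards its left end, stays inside \<open>A\<close> and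
    shifts the two distances by the number of steps.\<close>
  have forward: "sh (int i) x \<in> A \<and> fwd (sh (int i) x) = fwd x - i \<and> bwd (sh (int i) x) = bwd x + i"
    if "x \<in> A" "i < fwd x" for x i
  proof (intro conjI)
    show "sh (int i) x \<in> A"
      using that outside fwd_min by (cases "i = 0") auto
    show "fwd (sh (int i) x) = fwd x - i"
      using that fwd(2)[of x] fwd_min[of "_ + i" x]
      by (intro fwd_eqI) (auto simp: of_nat_diff)
    show "bwd (sh (int i) x) = bwd x + i"
    proof (rule bwd_eqI)
      fix k assume k: "k < bwd x + i"
      show "sh (- int k) (sh (int i) x) \<notin> V"
      proof (cases "k < i")
        case True
        then show ?thesis
          using fwd_min[of "i - k" x] that by (simp add: of_nat_diff)
      next
        case False
        then show ?thesis
          using bwd_min[of "k - i" x] k by (simp add: of_nat_diff)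
      qed
    qed (use bwd(1)[of x] in simp)
  qed
  have backward: "sh (- int i) x \<in> A \<and> fwd (sh (- int i) x) = fwd x + i \<and>
      bwd (sh (- int i) x) = bwd x - i"
    if "x \<in> A" "i \<le> bwd x" for x i
  proof (intro conjI)
    show in_A: "sh (- int i) x \<in> A"
    proof (rule ccontr)
      assume out: "sh (- int i) x \<notin> A"
      then have "0 < i"
        using that(1) by (cases i) auto
      then have "sh (- int (i - 1)) x \<notin> V"
        using that by (intro bwd_min) auto
      moreover have "sh (- int (i - 1)) x \<in> V"
        using outside start[of "sh (- int (i - 1)) x"] out \<open>0 < i\<close>
        by (fastforce simp: of_nat_diff)
      ultimately show False by blast
    qed
    show "fwd (sh (- int i) x) = fwd x + i"
    proof (rule fwd_eqI)
      fix k assume k: "0 < k" "k < fwd x + i"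
      show "sh (int k) (sh (- int i) x) \<notin> V"
      proof (cases "k > i")
        case True
        then show ?thesis
          using fwd_min[of "k - i" x] k by (simp add: of_nat_diff)
      next
        case False
        then show ?thesis
          using bwd_min[of "i - k" x] k that by (simp add: of_nat_diff)
      qed
    qed (use fwd[of x] in simp_all)
    show "bwd (sh (- int i) x) = bwd x - i"
      using that bwd(1)[of x] bwd_min[of "_ + i" x]
      by (intro bwd_eqI) (auto simp: of_nat_diff algebra_simps)
  qed

  define B where "B = {x \<in> A. t dvd bwd x \<and> t \<le> fwd x}"
  define h where "h x = (if fwd x < 2 * t then fwd x else t)" for x
  have h_less: "t \<le> h x \<and> h x < 2 * t \<and> h x \<le> fwd x" if "x \<in> B" for x
    using that t by (auto simp: B_def h_def)
  have inside: "sh (int i) x \<in> A \<and> (0 < i \<longrightarrow> sh (int i) x \<notin> B)" if "x \<in> B" "i < h x" for x i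
  proof -
    have i: "x \<in> A" "i < fwd x"
      using h_less[OF that(1)] that by (auto simp: B_def)
    have "sh (int i) x \<notin> B" if "0 < i"
    proof
      assume "sh (int i) x \<in> B"
      then have "t dvd bwd x + i" "t \<le> fwd x - i"
        using forward[OF i] by (auto simp: B_def)
      then have "t dvd i"
        using \<open>x \<in> B\<close> by (simp add: B_def dvd_add_right_iff)
      then have "t \<le> i"
        using \<open>0 < i\<close> by (rule dvd_imp_le)
      then show False
        using \<open>i < h x\<close> \<open>t \<le> fwd x - i\<close> by (auto simp: h_def split: if_splits)
    qed
    then show ?thesis
      using forward[OF i] by blast
  qed
  have cover: "(\<exists>y\<in>B. \<exists>i<h y. x = sh (int i) y) \<or>
      (\<exists>k. 0 < k \<and> k < t \<and> sh (int k) x \<notin> A \<and> sh (int k - 1) x \<in> A)" if "x \<in> A" for x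
  proof -
    define r where "r = bwd x mod t"
    have r: "r < t" "r \<le> bwd x"
      using t by (auto simp: r_def)
    \<comment> \<open>\<open>y\<close> is the last division point at or before \<open>x\<close>.  It starts a block unless fewer than \<open>t\<close> steps
      remain in the piece; then the block starts \<open>t\<close> steps earlier, provided that is still in the
      piece.\<close>
    define y where "y = sh (- int r) x"
    have y: "y \<in> A" "fwd y = fwd x + r" "bwd y = bwd x - r" "x = sh (int r) y"
      using backward[OF \<open>x \<in> A\<close> r(2)] by (auto simp: y_def)
    have "t dvd bwd y"
      unfolding y(3) r_def by (rule dvd_minus_mod)
    consider (long) "t \<le> fwd y" | (last) "fwd y < t" "0 < bwd y" | (short) "fwd y < t" "bwd y = 0"
      by linarith
    then show ?thesis
    proof cases
      case long
      then have "y \<in> B"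
        using y(1) \<open>t dvd bwd y\<close> by (simp add: B_def)
      moreover from this have "r < h y"
        using h_less r(1) by fastforce
      ultimately show ?thesis
        using y(4) by blast
    next
      case last
      then have "t \<le> bwd y"
        using \<open>t dvd bwd y\<close> by (auto intro: dvd_imp_le)
      define u where "u = sh (- int t) y"
      have u: "u \<in> A" "fwd u = fwd y + t" "bwd u = bwd y - t"
        using backward[OF y(1) \<open>t \<le> bwd y\<close>] by (auto simp: u_def)
      then have "u \<in> B"
        using \<open>t dvd bwd y\<close> \<open>t \<le> bwd y\<close> by (auto simp: B_def)
      moreover have "r + t < h u"
        using last u(2) y(2) fwd(1)[of x] by (auto simp: h_def)
      moreover have "x = sh (int (r + t)) u"
        using y(4) by (simp add: u_def)
      ultimately show ?thesis by blast
    next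
      case short
      then have "y \<in> V"
        using bwd(1)[of y] by simp
      then obtain k where "k \<le> fwd y" "sh (int k) y \<notin> A"
        using spaced[of y "fwd y"] y(1) fwd[of y] short by auto
      moreover have "r < k"
      proof (rule ccontr)
        assume "\<not> r < k"
        then have "k < fwd y"
          using y(2) fwd(1)[of x] by linarith
        then show False
          using forward[OF y(1)] \<open>sh (int k) y \<notin> A\<close> by blast
      qed
      ultimately have "sh (int (k - r)) x \<notin> A"
        by (simp add: y_def of_nat_diff)
      then obtain m where "0 < m" "m \<le> k - r" "sh (int m) x \<notin> A" "sh (int m - 1) x \<in> A"
        using exists_exit[OF \<open>x \<in> A\<close>] by blast
      then show ?thesis
        using \<open>k \<le> fwd y\<close> short by (intro disjI2 exI[of _ m]) auto
    qed
  qed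

  have det_sh: "determined (M) (\<lambda>x. sh i x \<in> V)" if "\<bar>i\<bar> \<le> int G + 1" for i
    using that M by (intro determined_sh[OF det_V]) linarith
  have det_fwd: "determined (M) fwd"
  proof (rule determinedI)
    fix x y :: config assume agree: "\<bar>j\<bar> \<le> int (M) \<Longrightarrow> x j = y j" for j
    have "sh (int i) x \<in> V \<longleftrightarrow> sh (int i) y \<in> V" if "i \<le> G + 1" for i
      using that by (intro determinedD[OF det_sh agree]) auto
    then show "fwd x = fwd y"
      using fwd[of y] fwd_min[of _ y] by (intro fwd_eqI) auto
  qed
  have det_bwd: "determined (M) bwd"
  proof (rule determinedI)
    fix x y :: config assume agree: "\<bar>j\<bar> \<le> int (M) \<Longrightarrow> x j = y j" for j
    have "sh (- int i) x \<in> V \<longleftrightarrow> sh (- int i) y \<in> V" if "i \<le> G" for i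
      using that by (intro determinedD[OF det_sh agree]) auto
    then show "bwd x = bwd y"
      using bwd[of y] bwd_min[of _ y] by (intro bwd_eqI) auto
  qed
  have "determined (M) (\<lambda>x. x \<in> B)"
    unfolding B_def mem_Collect_eq
    by (intro determined_conj determined_mono[OF det_A] determined_compose[OF det_fwd]
        determined_compose[OF det_bwd]) (use M in simp)
  moreover have "determined (M) h"
    unfolding h_def by (rule determined_compose[OF det_fwd])
  ultimately show ?thesis
    using h_less inside cover by blast
qed

text \<open>
  Markers come from sieving the points of \<open>A\<close> that stay in \<open>A\<close> for \<open>t\<close> steps in both directions.
  Keeping this distance from the complement of \<open>A\<close> means that a marker cannot be too close to the
  beginning or the end of its stretch, so short pieces arise only from stretches that are themselves
  short.
\<close>

lemma exists_blocks:
  assumes t: "1 \<le> t" and det_A: "determined N (\<lambda>x. x \<in> A)" and "w \<le> N"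
    and distinct: "\<And>x i. x \<in> A \<Longrightarrow> sh (int i) x \<in> A \<Longrightarrow> 0 < i \<Longrightarrow> i < t \<Longrightarrow>
      \<exists>j. \<bar>j\<bar> \<le> int w \<and> x j \<noteq> sh (int i) x j"
    and M: "N + 3 * t + 3 * (2 * w + 1) * t + 2 \<le> M"
  shows "\<exists>B h. determined M (\<lambda>x. x \<in> B) \<and> determined M h \<and>
    (\<forall>x\<in>B. t \<le> h x \<and> h x < 2 * t) \<and>
    (\<forall>x\<in>B. \<forall>i<h x. sh (int i) x \<in> A \<and> (0 < i \<longrightarrow> sh (int i) x \<notin> B)) \<and>
    (\<forall>x\<in>A. (\<exists>y\<in>B. \<exists>i<h y. x = sh (int i) y) \<or>
      (\<exists>k. 0 < k \<and> k < t \<and> sh (int k) x \<notin> A \<and> sh (int k - 1) x \<in> A))"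
proof -
  define A' where "A' = {x. \<forall>i\<in>{- int t..int t}. sh i x \<in> A}"
  define R where "R = sieve t A' [- int w..int w]"
  define V where "V = {x. x \<notin> A \<or> sh (-1) x \<notin> A \<or> x \<in> R}"
  define D where "D = (2 * w + 1) * t"
  define N' where "N' = N + t + D"
  have len: "length [- int w..int w] * t = D"
    by (simp add: D_def nat_add_distrib nat_mult_distrib)
  have "R \<subseteq> A'"
    unfolding R_def by (rule sieve_subset)
  have det_R: "determined N' (\<lambda>x. x \<in> R)"
    unfolding R_def N'_def len[symmetric]
  proof (rule determined_sieve)
    show "determined (N + t) (\<lambda>x. x \<in> A')"
      unfolding A'_def mem_Collect_eq by (intro determined_ball determined_sh[OF det_A]) auto
  qed (use \<open>w \<le> N\<close> in auto)
  have det_A': "determined N' (\<lambda>x. x \<in> A)"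
    using det_A by (rule determined_mono) (simp add: N'_def)
  have det_V: "determined N' (\<lambda>x. x \<in> V)"
    unfolding V_def mem_Collect_eq
    using t by (intro determined_disj determined_not det_R det_A' determined_sh[OF det_A])
      (simp add: N'_def)
  have gap: "\<exists>i\<le>2 * D + 2 * t. sh (int i) x \<in> V" for x
  proof (rule ccontr)
    assume none: "\<not> (\<exists>i\<le>2 * D + 2 * t. sh (int i) x \<in> V)"
    have in_A: "sh i x \<in> A" if "0 \<le> i" "i \<le> int (2 * D + 2 * t)" for i
      using none that by (auto simp: V_def dest!: spec[of _ "nat i"])
    \<comment> \<open>The middle of the gap is deep enough inside \<open>A\<close> to be a candidate, and a marker within
      distance \<open>D\<close> of it still lies in the gap.\<close>
    have "sh (int (D + t)) x \<in> A'"
      unfolding A'_def by (auto intro!: in_A)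
    then obtain i where "\<bar>i\<bar> \<le> int D" "sh i (sh (int (D + t)) x) \<in> R"
      using sieve_dense[of _ A' "[- int w..int w]" t] unfolding len R_def by blast
    moreover from this have "0 \<le> i + int (D + t)"
      by linarith
    ultimately have "nat (i + int (D + t)) \<le> 2 * D + 2 * t" "sh (int (nat (i + int (D + t)))) x \<in> V"
      by (simp_all add: V_def)
    then show False
      using none by blast
  qed
  have spaced: "\<exists>k\<le>i. sh (int k) x \<notin> A"
    if V: "x \<in> V" and "x \<in> A" "0 < i" "i < t" and V': "sh (int i) x \<in> V" for x i
  proof (rule ccontr)
    assume "\<not> ?thesis"
    then have in_A: "sh (int k) x \<in> A" if "k \<le> i" for k
      using that by blast
    have "int (i - 1) = -1 + int i"
      using \<open>0 < i\<close> by simp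
    then have "sh (int i) x \<in> R"
      using V' in_A[of i] in_A[of "i - 1"] by (auto simp: V_def)
    have "x \<in> R"
    proof (rule ccontr)
      assume "x \<notin> R"
      then have "sh (-1) x \<notin> A"
        using V \<open>x \<in> A\<close> by (auto simp: V_def)
      moreover have "sh (- int i - 1) (sh (int i) x) \<in> A"
        using \<open>sh (int i) x \<in> R\<close> \<open>R \<subseteq> A'\<close> \<open>i < t\<close> unfolding A'_def by fastforce
      ultimately show False by simp
    qed
    have "x j = sh (int i) x j" if "\<bar>j\<bar> \<le> int w" for j
      using sieve_separated[of x t A' "[- int w..int w]" "int i" j] \<open>x \<in> R\<close> \<open>sh (int i) x \<in> R\<close>
        that \<open>i < t\<close> by (simp add: R_def abs_le_iff)
    then show False
      using distinct[OF \<open>x \<in> A\<close> in_A[of i]] \<open>0 < i\<close> \<open>i < t\<close> by auto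
  qed
  show ?thesis
  proof (rule cut_into_blocks[OF t det_A' det_V _ _ gap])
    show "N' + (2 * D + 2 * t) + 1 \<le> M"
      using M by (simp add: N'_def D_def algebra_simps)
  qed (use spaced in \<open>auto simp: V_def\<close>)
qed

section \<open>Periodic configurations\<close>

definition periodic :: "nat \<Rightarrow> config \<Rightarrow> bool" where
  "periodic t z \<longleftrightarrow> (\<exists>p. 1 \<le> p \<and> p < t \<and> sh (int p) z = z)"

definition period :: "config \<Rightarrow> nat" where
  "period z = (LEAST p. 1 \<le> p \<and> sh (int p) z = z)"

lemma period:
  assumes "periodic t z"
  shows "1 \<le> period z" "period z < t" "sh (int (period z)) z = z"
proof -
  obtain p where p: "p < t" "1 \<le> p \<and> sh (int p) z = z"
    using assms by (auto simp: periodic_def)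
  show "1 \<le> period z" "sh (int (period z)) z = z"
    unfolding period_def using LeastI[of "\<lambda>p. 1 \<le> p \<and> sh (int p) z = z", OF p(2)] by blast+
  show "period z < t"
    unfolding period_def using Least_le[of "\<lambda>p. 1 \<le> p \<and> sh (int p) z = z", OF p(2)] p(1) by simp
qed

lemma period_le: "1 \<le> p \<Longrightarrow> sh (int p) z = z \<Longrightarrow> period z \<le> p"
  unfolding period_def by (rule Least_le) simp

lemma sh_mult_period:
  assumes "sh p z = z"
  shows "sh (k * p) z = z"
proof -
  have nat: "sh (int n * p) z = z" for n
  proof (induction n)
    case (Suc n)
    have "sh (int (Suc n) * p) z = sh p (sh (int n * p) z)"
      by (simp add: algebra_simps)
    then show ?case
      using Suc assms by simp
  qed simp
  show ?thesis
  proof (cases "k \<ge> 0")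
    case True
    then show ?thesis using nat[of "nat k"] by simp
  next
    case False
    then have "sh (k * p) (sh (int (nat (- k)) * p) z) = z"
      by simp
    then show ?thesis
      by (simp only: nat)
  qed
qed

lemma periodic_value:
  assumes "sh p z = z" "i mod p = j mod p"
  shows "z i = z j"
proof -
  obtain k where "j = i + p * k"
    using assms(2) mod_eq_dvd_iff[of j p i] by (metis add_diff_cancel_left' add_diff_eq dvdE)
  then have "i = j - k * p"
    by (simp add: algebra_simps)
  then show ?thesis
    using fun_cong[OF sh_mult_period[OF assms(1), of k], of j] by (simp add: sh_apply)
qed

text \<open>
  A variant of the Fine--Wilf theorem: the overlap is long enough to transfer the period \<open>p\<close> of \<open>z\<close>
  to \<open>z'\<close>, and then one period of agreement suffices.
\<close>

lemma periodic_eqI: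
  assumes p: "sh p z = z" "0 < p" and q: "sh q z' = z'" "0 < q"
    and agree: "\<And>j. a \<le> j \<Longrightarrow> j < a + p + q \<Longrightarrow> z j = z' j"
  shows "z = z'"
proof
  fix j
  have "z' (n + p) = z' n" for n
  proof -
    define m where "m = a + (n - a) mod q"
    have m: "a \<le> m" "m < a + q"
      using q(2) by (auto simp: m_def)
    have "m mod q = n mod q"
      unfolding m_def by (metis add_diff_cancel_left' add.commute diff_add_cancel mod_add_right_eq)
    then have "z' n = z' m" "z' (n + p) = z' (m + p)"
      using periodic_value[OF q(1)] by (metis, metis mod_add_left_eq)
    moreover have "z' m = z m" "z' (m + p) = z (m + p)"
      using agree[of m] agree[of "m + p"] m p(2) q(2) by auto
    moreover have "z m = z (m + p)"
      by (rule periodic_value[OF p(1)]) simp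
    ultimately show ?thesis by simp
  qed
  from this[of "_ - p"] have p': "sh p z' = z'"
    by (simp add: sh_def)
  define m where "m = a + (j - a) mod p"
  have m: "a \<le> m" "m < a + p"
    using p(2) by (auto simp: m_def)
  have "m mod p = j mod p"
    unfolding m_def by (metis add_diff_cancel_left' add.commute diff_add_cancel mod_add_right_eq)
  then have "z j = z m" "z' j = z' m"
    using periodic_value[OF p(1)] periodic_value[OF p'] by metis+
  then show "z j = z' j"
    using agree[of m] m q(2) by auto
qed

text \<open>
  The choice depends only on the orbit as a set, so all points of an orbit have the same
  representative; this fixes a phase for each periodic orbit.
\<close>

definition orbit_rep :: "config \<Rightarrow> config" where
  "orbit_rep z = (SOME y. y \<in> range (\<lambda>i. sh i z))"

definition reps :: "nat \<Rightarrow> config set" where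
  "reps t = {z. periodic t z \<and> orbit_rep z = z}"

lemma orbit_rep_sh: "orbit_rep (sh i z) = orbit_rep z"
proof -
  have "y \<in> range (\<lambda>k. sh k (sh i z))" if "y \<in> range (\<lambda>k. sh k z)" for y
  proof -
    from that obtain k where "y = sh k z"
      by blast
    then show ?thesis
      by (intro image_eqI[of _ _ "k - i"]) simp_all
  qed
  then have "range (\<lambda>k. sh k (sh i z)) = range (\<lambda>k. sh k z)"
    by auto
  then show ?thesis
    by (simp add: orbit_rep_def)
qed

lemma orbit_rep_in_orbit: "\<exists>i. orbit_rep z = sh i z"
proof -
  have "orbit_rep z \<in> range (\<lambda>i. sh i z)"
    unfolding orbit_rep_def by (rule someI[of _ z], rule image_eqI[of _ _ 0]) simp_all
  then show ?thesis by blast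
qed

lemma reps_unique:
  assumes "z \<in> reps t" "z' \<in> reps t" "z' = sh (int i) z" "i < period z"
  shows "i = 0 \<and> z = z'"
proof -
  have "z = z'"
    using assms(1-3) orbit_rep_sh[of "int i" z] by (simp add: reps_def)
  then have "sh (int i) z = z"
    using assms(3) by simp
  then have "i = 0"
    using period_le[of i z] assms(4) by linarith
  with \<open>z = z'\<close> show ?thesis by simp
qed

lemma reps_exist:
  assumes "periodic t z"
  obtains z' i where "z' \<in> reps t" "i < period z'" "z = sh (int i) z'"
proof -
  define z' where "z' = orbit_rep z"
  obtain k where k: "z' = sh k z"
    using orbit_rep_in_orbit z'_def by blast
  have "sh (int p) z' = z'" if "sh (int p) z = z" for p
  proof -
    have "sh (int p) z' = sh k (sh (int p) z)"
      by (simp add: k add.commute)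
    then show ?thesis
      using that k by simp
  qed
  then have per: "periodic t z'"
    using assms by (auto simp: periodic_def)
  then have "z' \<in> reps t"
    using orbit_rep_sh[of k z] by (simp add: reps_def flip: k z'_def)
  define p where "p = int (period z')"
  have p: "0 < p" "sh p z' = z'"
    using period[OF per] by (simp_all add: p_def)
  have "sh ((- k) mod p) z' = sh (- k) (sh (- ((- k) div p) * p) z')"
    by (simp flip: minus_div_mult_eq_mod)
  also have "\<dots> = z"
    by (simp only: sh_mult_period[OF p(2)]) (simp add: k)
  finally have "z = sh (int (nat ((- k) mod p))) z'"
    using p(1) by simp
  moreover have "nat ((- k) mod p) < period z'"
    using p(1) by (simp add: p_def nat_less_iff)
  ultimately show ?thesis
    using that \<open>z' \<in> reps t\<close> by blast
qed

lemma finite_reps: "finite (reps t)"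
proof (rule inj_on_finite[OF _ _ finite_patterns])
  show "window_proj t ` reps t \<subseteq> patterns t"
    by (auto simp: window_proj_def patterns_def)
  show "inj_on (window_proj t) (reps t)"
  proof (rule inj_onI)
    fix z z' assume "z \<in> reps t" "z' \<in> reps t" and eq: "window_proj t z = window_proj t z'"
    then have "periodic t z" "periodic t z'"
      by (simp_all add: reps_def)
    note period[OF this(1)] period[OF this(2)]
    then show "z = z'"
    proof (intro periodic_eqI[of "int (period z)" z "int (period z')" z' "- int t"])
      fix j assume "- int t \<le> j" "j < - int t + int (period z) + int (period z')"
      then have "j \<in> window t"
        using \<open>period z < t\<close> \<open>period z' < t\<close> by (simp add: window_def)
      then show "z j = z' j"
        using fun_cong[OF eq, of j] by (simp add: window_proj_def)
    qed auto
  qed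
qed

section \<open>Towers over periodic stretches\<close>

text \<open>
  The interval grows only to the right, in steps of one period, so that returning after one period
  amounts to increasing \<open>k\<close> by one.  The initial part \<open>[-2t, 2t]\<close> is so long that two such
  intervals, displaced by less than \<open>t\<close>, overlap in an interval as long as the sum of two periods
  below \<open>t\<close>.
\<close>

definition shadow :: "nat \<Rightarrow> config \<Rightarrow> nat \<Rightarrow> config set" where
  "shadow t z k = {x. \<forall>j\<in>{- 2 * int t..2 * int t + int (k * period z)}. x j = z j}"

lemma determined_shadow:
  assumes "periodic t z" "k \<le> n" "2 * t + n * t \<le> N"
  shows "determined N (\<lambda>x. x \<in> shadow t z k)"
proof -
  have "k * period z \<le> n * t"
    using period(2)[OF assms(1)] assms(2) by (intro mult_le_mono) auto
  then have "2 * int t + int (k * period z) \<le> int N"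
    using assms(3) by linarith
  then show ?thesis
    unfolding shadow_def mem_Collect_eq
    by (intro determined_ball determined_compose[OF determined_coord])
      (auto simp: abs_le_iff simp del: of_nat_mult)
qed

lemma shadow_in: "z \<in> shadow t z k"
  by (simp add: shadow_def)

lemma shadow_antimono: "k \<le> m \<Longrightarrow> shadow t z m \<subseteq> shadow t z k"
proof -
  assume "k \<le> m"
  then have "int (k * period z) \<le> int (m * period z)"
    by (intro of_nat_mono mult_le_mono) auto
  then show ?thesis
    unfolding shadow_def by fastforce
qed

lemma shadow_return:
  assumes "periodic t z"
  shows "(shift ^^ period z) ` shadow t z k \<inter> shadow t z k = shadow t z (Suc k)"
proof -
  let ?p = "int (period z)"
  have per: "z (j + ?p) = z j" for j
    using fun_cong[OF period(3)[OF assms], of "j + ?p"] by (simp add: sh_apply)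
  have p: "?p \<le> int t" "1 \<le> ?p"
    using period[OF assms] by auto
  have "sh (- ?p) x \<in> shadow t z k \<longleftrightarrow>
      (\<forall>j\<in>{- 2 * int t + ?p..2 * int t + int (Suc k * period z)}. x j = z j)" for x
  proof -
    have "sh (- ?p) x \<in> shadow t z k \<longleftrightarrow>
        (\<forall>j\<in>{- 2 * int t..2 * int t + int (k * period z)}. x (j + ?p) = z (j + ?p))"
      by (simp add: shadow_def sh_apply per)
    also have "\<dots> \<longleftrightarrow> (\<forall>j\<in>(\<lambda>j. j + ?p) ` {- 2 * int t..2 * int t + int (k * period z)}. x j = z j)"
      by blast
    also have "(\<lambda>j. j + ?p) ` {- 2 * int t..2 * int t + int (k * period z)} =
        {- 2 * int t + ?p..2 * int t + int (Suc k * period z)}"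
      by (simp only: image_add_atLeastAtMost') (simp add: algebra_simps)
    finally show ?thesis .
  qed
  note shifted = this
  have union: "{- 2 * int t + ?p..2 * int t + int (Suc k * period z)} \<union>
      {- 2 * int t..2 * int t + int (k * period z)} =
      {- 2 * int t..2 * int t + int (Suc k * period z)}"
    using p by (auto simp del: of_nat_mult)
  show ?thesis
  proof (rule set_eqI)
    fix x
    have "x \<in> (shift ^^ period z) ` shadow t z k \<inter> shadow t z k \<longleftrightarrow>
        sh (- ?p) x \<in> shadow t z k \<and> x \<in> shadow t z k"
      by (simp only: shift_pow_image Int_iff mem_Collect_eq)
    also have "\<dots> \<longleftrightarrow> x \<in> shadow t z (Suc k)"
      unfolding shifted by (simp only: shadow_def mem_Collect_eq ball_Un flip: union)
    finally show "x \<in> (shift ^^ period z) ` shadow t z k \<inter> shadow t z k \<longleftrightarrow>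
        x \<in> shadow t z (Suc k)" .
  qed
qed

lemma shadow_disjoint:
  assumes z: "z \<in> reps t" "z' \<in> reps t" and "i < period z"
    and "x \<in> shadow t z k" "sh (int i) x \<in> shadow t z' m"
  shows "i = 0 \<and> z = z'"
proof -
  note per = period[of t z] period[of t z']
  have t: "periodic t z" "periodic t z'"
    using z by (simp_all add: reps_def)
  have "sh (int i) z = z'"
  proof (rule periodic_eqI)
    have "sh (int (period z)) (sh (int i) z) = sh (int i) (sh (int (period z)) z)"
      by (simp add: add.commute)
    then show "sh (int (period z)) (sh (int i) z) = sh (int i) z"
      using per t by simp
    fix j assume j: "- int t \<le> j" "j < - int t + int (period z) + int (period z')"
    then have "j \<le> int t"
      using per t by linarith
    have "j \<in> {- 2 * int t..2 * int t + int (m * period z')}"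
      "j - int i \<in> {- 2 * int t..2 * int t + int (k * period z)}"
      using j \<open>j \<le> int t\<close> per(2)[OF t(1)] \<open>i < period z\<close> unfolding atLeastAtMost_iff by linarith+
    then have "sh (int i) x j = z' j" "x (j - int i) = z (j - int i)"
      using assms(4,5) unfolding shadow_def by blast+
    then show "sh (int i) z j = z' j"
      by (simp add: sh_apply)
  qed (use per t in auto)
  then show ?thesis
    using reps_unique[OF z _ \<open>i < period z\<close>] by simp
qed

text \<open>Extending one period of \<open>x\<close>, taken at the left end of the window, to a periodic configuration.\<close>

lemma periodic_of_overlap:
  assumes "1 \<le> q" "q < t" and rep: "\<And>j. \<bar>j\<bar> \<le> int w \<Longrightarrow> x j = sh (int q) x j"
  obtains z where "periodic t z" "\<And>j. \<bar>j\<bar> \<le> int w \<Longrightarrow> x j = z j"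
proof -
  define z where "z j = x ((j + int w) mod int q - int w)" for j
  have "sh (int q) z = z"
  proof
    fix j
    have "(j - int q + int w) mod int q = (j + int w) mod int q"
      using minus_mod_self2[of "j + int w" "int q"] by (simp add: algebra_simps)
    then show "sh (int q) z j = z j"
      by (simp add: z_def sh_apply)
  qed
  then have "periodic t z"
    using assms by (auto simp: periodic_def)
  moreover have extend: "- int w + int n \<le> int w \<Longrightarrow> x (- int w + int n) = z (- int w + int n)" for n
  proof (induction n rule: less_induct)
    case (less n)
    show ?case
    proof (cases "n < q")
      case True
      then show ?thesis by (simp add: z_def)
    next
      case False
      then have "x (- int w + int n) = x (- int w + int (n - q))"
        using rep[of "- int w + int n"] less.prems by (simp add: sh_apply of_nat_diff abs_le_iff algebra_simps)
      also have "\<dots> = z (- int w + int (n - q))"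
        using less.IH[of "n - q"] less.prems assms(1) False by simp
      also have "\<dots> = sh (int q) z (- int w + int n)"
        using False by (simp add: sh_apply of_nat_diff algebra_simps)
      finally show ?thesis
        by (simp add: \<open>sh (int q) z = z\<close>)
    qed
  qed
  have "x j = z j" if "\<bar>j\<bar> \<le> int w" for j
    using extend[of "nat (j + int w)"] that by (simp add: abs_le_iff)
  ultimately show ?thesis
    using that by blast
qed

text \<open>
  If the tower over \<open>b\<^sub>k = shadow t z k\<close> is not closed, passing from \<open>k\<close> to \<open>k + 1\<close> loses at least the
  fraction \<open>\<delta>\<close> of the measure, because \<open>b\<^bsub>k+1\<^esub>\<close> is the part of \<open>b\<^sub>k\<close> that returns after one period.
\<close>

lemma exists_stable_scale:
  assumes "prob_space \<mu>" "sets \<mu> = sets borel" "periodic t z"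
    and "0 < \<delta>" "\<delta> \<le> 1" "(1 - \<delta>) ^ n \<le> \<upsilon>"
  shows "\<exists>k\<le>n. tower_closed \<mu> \<delta> (shadow t z k) (period z) \<or>
    measure \<mu> (shadow t z k) \<le> \<upsilon> * measure \<mu> (shadow t z 0)"
proof (cases "\<exists>k\<le>n. tower_closed \<mu> \<delta> (shadow t z k) (period z)")
  case False
  have "k \<le> n \<Longrightarrow> measure \<mu> (shadow t z k) \<le> (1 - \<delta>) ^ k * measure \<mu> (shadow t z 0)" for k
  proof (induction k)
    case (Suc k)
    have "\<not> tower_closed \<mu> \<delta> (shadow t z k) (period z)"
      using False Suc.prems by (meson Suc_leD)
    then have "measure \<mu> (shadow t z (Suc k)) \<le> (1 - \<delta>) * measure \<mu> (shadow t z k)"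
      by (simp add: tower_closed_def shadow_return[OF assms(3)])
    also have "\<dots> \<le> (1 - \<delta>) * ((1 - \<delta>) ^ k * measure \<mu> (shadow t z 0))"
      using Suc assms(5) by (intro mult_left_mono) auto
    finally show ?case by simp
  qed simp
  from this[of n] have "measure \<mu> (shadow t z n) \<le> (1 - \<delta>) ^ n * measure \<mu> (shadow t z 0)"
    by simp
  also have "\<dots> \<le> \<upsilon> * measure \<mu> (shadow t z 0)"
    using assms(6) by (intro mult_right_mono) auto
  finally show ?thesis by blast
qed blast

text \<open>
  For a closed tower these are the points where an orbit enters it.  The base of a tower that is not
  closed counts in full, since such a tower has to be discarded altogether.
\<close>

definition entry :: "config measure \<Rightarrow> real \<Rightarrow> config set \<Rightarrow> nat \<Rightarrow> config set" where
  "entry \<mu> \<delta> b p = (if tower_closed \<mu> \<delta> b p then b - (shift ^^ p) ` b else b)"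

lemma determined_entry:
  assumes "determined N (\<lambda>x. x \<in> b)" "N + p \<le> M"
  shows "determined M (\<lambda>x. x \<in> entry \<mu> \<delta> b p)"
proof -
  have "determined M (\<lambda>x. x \<in> b \<and> sh (- int p) x \<notin> b)" "determined M (\<lambda>x. x \<in> b)"
    using assms(2) by (auto intro!: determined_conj determined_not determined_sh[OF assms(1)]
        determined_mono[OF assms(1)])
  then show ?thesis
    by (simp add: entry_def shift_pow_image)
qed

lemma measure_entry:
  assumes "prob_space \<mu>" "sets \<mu> = sets borel" "periodic t z" "0 \<le> \<delta>" "0 \<le> \<upsilon>"
    and "tower_closed \<mu> \<delta> (shadow t z k) (period z) \<or>
      measure \<mu> (shadow t z k) \<le> \<upsilon> * measure \<mu> (shadow t z 0)"
  shows "measure \<mu> (entry \<mu> \<delta> (shadow t z k) (period z)) \<le> (\<upsilon> + \<delta>) * measure \<mu> (shadow t z 0)"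
proof -
  interpret prob_space \<mu> by fact
  have meas: "shadow t z m \<in> sets \<mu>" for m
    using n_defined_borel[unfolded n_defined_iff, OF determined_shadow[OF assms(3) order_refl order_refl]]
      assms(2) by simp
  show ?thesis
  proof (cases "tower_closed \<mu> \<delta> (shadow t z k) (period z)")
    case True
    have "entry \<mu> \<delta> (shadow t z k) (period z) = shadow t z k - shadow t z (Suc k)"
      using True shadow_return[OF assms(3), of k] by (auto simp: entry_def)
    also have "measure \<mu> \<dots> = measure \<mu> (shadow t z k) - measure \<mu> (shadow t z (Suc k))"
      using meas shadow_antimono[of k "Suc k"] by (intro finite_measure_Diff) auto
    also have "\<dots> \<le> \<delta> * measure \<mu> (shadow t z k)"
      using True by (simp add: tower_closed_def shadow_return[OF assms(3)] algebra_simps)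
    also have "\<dots> \<le> \<delta> * measure \<mu> (shadow t z 0)"
      using assms(4) shadow_antimono[of 0 k] meas by (intro mult_left_mono finite_measure_mono) auto
    also have "\<dots> \<le> (\<upsilon> + \<delta>) * measure \<mu> (shadow t z 0)"
      using assms(5) by (intro mult_right_mono) auto
    finally show ?thesis .
  next
    case False
    then have "measure \<mu> (entry \<mu> \<delta> (shadow t z k) (period z)) \<le> \<upsilon> * measure \<mu> (shadow t z 0)"
      using assms(6) by (simp add: entry_def)
    also have "\<dots> \<le> (\<upsilon> + \<delta>) * measure \<mu> (shadow t z 0)"
      using assms(4) by (intro mult_right_mono) auto
    finally show ?thesis .
  qed
qed

text \<open>
  The bound for a single \<open>z\<close> is relative to the measure of \<open>shadow t z 0\<close>.  As these sets are disjoint,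
  adding up over the exponentially many representatives costs nothing.
\<close>

lemma measure_entries:
  assumes "prob_space \<mu>" "sets \<mu> = sets borel" "0 \<le> \<delta>" "0 \<le> \<upsilon>"
    and scale: "\<And>z. z \<in> reps t \<Longrightarrow> tower_closed \<mu> \<delta> (shadow t z (\<kappa> z)) (period z) \<or>
      measure \<mu> (shadow t z (\<kappa> z)) \<le> \<upsilon> * measure \<mu> (shadow t z 0)"
  shows "measure \<mu> (\<Union>z\<in>reps t. entry \<mu> \<delta> (shadow t z (\<kappa> z)) (period z)) \<le> \<upsilon> + \<delta>"
proof -
  interpret prob_space \<mu> by fact
  have per: "periodic t z" if "z \<in> reps t" for z
    using that by (simp add: reps_def)
  have borel: "b \<in> sets \<mu>" if "determined N (\<lambda>x. x \<in> b)" for N b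
    using n_defined_borel[unfolded n_defined_iff, OF that] assms(2) by simp
  have meas: "shadow t z m \<in> sets \<mu>" if "z \<in> reps t" for z m
    by (rule borel, rule determined_shadow[OF per[OF that] order_refl order_refl])
  have "measure \<mu> (\<Union>z\<in>reps t. entry \<mu> \<delta> (shadow t z (\<kappa> z)) (period z)) \<le>
      (\<Sum>z\<in>reps t. measure \<mu> (entry \<mu> \<delta> (shadow t z (\<kappa> z)) (period z)))"
    using borel[OF determined_entry[OF determined_shadow[OF per order_refl order_refl] order_refl]]
    by (intro finite_measure_subadditive_finite finite_reps) auto
  also have "\<dots> \<le> (\<Sum>z\<in>reps t. (\<upsilon> + \<delta>) * measure \<mu> (shadow t z 0))"
    using assms per by (intro sum_mono measure_entry) auto
  also have "\<dots> = (\<upsilon> + \<delta>) * measure \<mu> (\<Union>z\<in>reps t. shadow t z 0)"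
  proof -
    have "disjoint_family_on (\<lambda>z. shadow t z 0) (reps t)"
      using shadow_disjoint[of _ t _ 0] period(1)[OF per]
      unfolding disjoint_family_on_def by fastforce
    then show ?thesis
      using meas by (subst finite_measure_finite_Union) (auto simp: finite_reps sum_distrib_left)
  qed
  also have "\<dots> \<le> \<upsilon> + \<delta>"
    using assms(3,4) by (intro mult_left_le prob_le_1) simp
  finally show ?thesis .
qed

section \<open>Assembling the towers\<close>

lemma in_Tow: "x \<in> Tow b j \<longleftrightarrow> (\<exists>y\<in>b. \<exists>i<j. x = sh (int i) y)"
  unfolding Tow_def by (auto simp: shift_pow image_def)

text \<open>
  A point with two positions in the towers gives, after moving both back until the lower one reaches its
  base, a base point whose orbit meets a base before it has left its own tower.
\<close>

lemma tower_partitionI: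
  assumes "finite \<T>"
    and towers: "\<And>b j. (b, j) \<in> \<T> \<Longrightarrow> b \<noteq> {} \<and> 1 \<le> j \<and> n_defined N b"
    and no_return: "\<And>b j b' j' x i. (b, j) \<in> \<T> \<Longrightarrow> (b', j') \<in> \<T> \<Longrightarrow> x \<in> b \<Longrightarrow> i < j \<Longrightarrow>
      sh (int i) x \<in> b' \<Longrightarrow> i = 0 \<and> b = b' \<and> j = j'"
  shows "tower_partition (\<Union>(b, j)\<in>\<T>. Tow b j) \<T>"
proof -
  have meet_le: "i = i' \<and> b = b' \<and> j = j'"
    if "(b, j) \<in> \<T>" "(b', j') \<in> \<T>" "x \<in> b" "x' \<in> b'" "i < j" "i' < j'"
      "sh (int i) x = sh (int i') x'" "i \<le> i'" for b j b' j' x x' i i'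
  proof -
    have "x = sh (- int i) (sh (int i') x')"
      by (simp flip: that(7))
    then have "sh (int (i' - i)) x' \<in> b"
      using \<open>x \<in> b\<close> \<open>i \<le> i'\<close> by (simp add: of_nat_diff)
    then have "i' - i = 0 \<and> b' = b \<and> j' = j"
      using that by (intro no_return[of b' j' b j x']) auto
    then show ?thesis
      using \<open>i \<le> i'\<close> by auto
  qed
  have meet: "i = i' \<and> b = b' \<and> j = j'"
    if "(b, j) \<in> \<T>" "(b', j') \<in> \<T>" "x \<in> b" "x' \<in> b'" "i < j" "i' < j'"
      "sh (int i) x = sh (int i') x'" for b j b' j' x x' i i'
    using meet_le[OF that] meet_le[OF that(2,1,4,3,6,5) that(7)[symmetric]] nat_le_linear[of i i']
    by blast
  have "disjoint_family_on (\<lambda>i. (shift ^^ i) ` b) {..<j}" if "(b, j) \<in> \<T>" for b j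
    using meet[OF that that] unfolding disjoint_family_on_def by (fastforce simp: shift_pow)
  then have "\<forall>(b, j)\<in>\<T>. b \<noteq> {} \<and> clopen_tower b j"
    using towers n_defined_open n_defined_closed by (fastforce simp: clopen_tower_def)
  moreover have "disjoint_family_on (\<lambda>(b, j). Tow b j) \<T>"
    unfolding disjoint_family_on_def disjoint_iff split_beta in_Tow
  proof (intro ballI impI allI)
    fix m n x assume mn: "m \<in> \<T>" "n \<in> \<T>" "m \<noteq> n" and "\<exists>y\<in>fst m. \<exists>i<snd m. x = sh (int i) y"
    then obtain y i where y: "y \<in> fst m" "i < snd m" "x = sh (int i) y"
      by blast
    show "\<not> (\<exists>y\<in>fst n. \<exists>i<snd n. x = sh (int i) y)"
    proof
      assume "\<exists>y\<in>fst n. \<exists>i<snd n. x = sh (int i) y"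
      then obtain y' i' where y': "y' \<in> fst n" "i' < snd n" "x = sh (int i') y'"
        by blast
      have "fst m = fst n \<and> snd m = snd n"
        using meet[of "fst m" "snd m" "fst n" "snd n" y y' i i'] mn y y' by simp
      then show False
        using \<open>m \<noteq> n\<close> by (simp add: prod_eq_iff)
    qed
  qed
  ultimately show ?thesis
    using \<open>finite \<T>\<close> unfolding tower_partition_def by simp
qed

text \<open>
  The radius \<open>N\<close> serves twice: membership in the periodic towers is decided by the coordinates in
  \<open>[-N, N]\<close>, and outside these towers the same coordinates distinguish times less than \<open>t\<close> apart.
\<close>

lemma towers_at_scale:
  fixes \<upsilon> \<delta> \<eta> :: real
  assumes t: "1 \<le> t" and \<delta>: "0 < \<delta>" "\<delta> \<le> 1" and \<upsilon>: "0 \<le> \<upsilon>" and \<eta>: "0 \<le> \<eta>"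
    and n: "(1 - \<delta>) ^ n \<le> \<upsilon>"
    and \<mu>: "prob_space \<mu>" "sets \<mu> = sets borel" and inv: "approx_invariant M \<eta> \<mu>"
    and N: "N = n * t + 3 * t" and M: "N + 5 * t + 3 * (2 * N + 1) * t + 2 \<le> M"
  shows "\<exists>e \<T>. n_defined M e \<and>
    measure \<mu> e \<le> (2 * real t + 1) * (\<upsilon> + \<delta> + t * \<eta>) \<and>
    tower_partition (UNIV - e) \<T> \<and>
    (\<forall>(b, j)\<in>\<T>. tower_n_defined M b j) \<and>
    (\<forall>(b, j)\<in>\<T>. (j < t \<and> tower_closed \<mu> \<delta> b j) \<or> (t \<le> j \<and> j < 2 * t)) \<and>
    (\<forall>(b, j)\<in>\<T>. is_singleton (window_proj (max j t) ` b))"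
proof -
  interpret prob_space \<mu> by fact
  have per: "periodic t z" if "z \<in> reps t" for z
    using that by (simp add: reps_def)
  note per = per period[OF per]
  obtain \<kappa> where \<kappa>: "\<And>z. z \<in> reps t \<Longrightarrow> \<kappa> z \<le> n"
    "\<And>z. z \<in> reps t \<Longrightarrow> tower_closed \<mu> \<delta> (shadow t z (\<kappa> z)) (period z) \<or>
      measure \<mu> (shadow t z (\<kappa> z)) \<le> \<upsilon> * measure \<mu> (shadow t z 0)"
    using exists_stable_scale[OF \<mu> per(1) \<delta> n] by metis
  define P where "P z = shadow t z (\<kappa> z)" for z
  have det_P: "determined (n * t + 2 * t) (\<lambda>x. x \<in> P z)" if "z \<in> reps t" for z
    unfolding P_def by (rule determined_shadow[OF per(1)[OF that] \<kappa>(1)[OF that]]) simp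
  define U where "U = (\<Union>z\<in>reps t. Tow (P z) (period z))"
  define S where "S = (\<Union>z\<in>reps t. entry \<mu> \<delta> (P z) (period z))"

  have det_Tow: "determined N (\<lambda>x. x \<in> Tow (P z) (period z))" if "z \<in> reps t" for z
    unfolding Tow_def UN_iff shift_pow_image mem_Collect_eq
    using per(3)[OF that] N by (intro determined_bex determined_sh[OF det_P[OF that]]) auto
  have det_U: "determined N (\<lambda>x. x \<in> U)"
    unfolding U_def UN_iff by (intro determined_bex det_Tow)
  have det_S: "determined N (\<lambda>x. x \<in> S)"
    unfolding S_def UN_iff
    using per(3) N by (intro determined_bex determined_entry[OF det_P]) (auto intro: less_imp_le)
  have P_U: "P z \<subseteq> U" if "z \<in> reps t" for z
    unfolding U_def using that per(2)[OF that] by (force simp: in_Tow intro!: exI[of _ 0])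
  \<comment> \<open>Neither a higher level of a tower nor a point continuing the same stretch has its
    predecessor outside \<open>U\<close>.\<close>
  have enter: "x \<in> S" if "x \<in> U" "sh (-1) x \<notin> U" for x
  proof -
    obtain z y i where z: "z \<in> reps t" "y \<in> P z" "i < period z" "x = sh (int i) y"
      using \<open>x \<in> U\<close> by (auto simp: U_def in_Tow)
    have later: "sh (int k) y' \<in> U" if "y' \<in> P z" "k < period z" for y' k
      using that z(1) by (auto simp: U_def in_Tow)
    have "i = 0"
    proof (rule ccontr)
      assume "i \<noteq> 0"
      then have "sh (-1) x = sh (int (i - 1)) y"
        using z(4) by (simp add: of_nat_diff)
      then show False
        using later[OF z(2), of "i - 1"] z(3) that(2) by simp
    qed
    moreover have "sh (- int (period z)) x \<notin> P z"
    proof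
      assume "sh (- int (period z)) x \<in> P z"
      from later[OF this, of "period z - 1"] show False
        using per(2)[OF z(1)] that(2) by (simp add: of_nat_diff)
    qed
    ultimately have "x \<in> entry \<mu> \<delta> (P z) (period z)"
      using z by (simp add: entry_def shift_pow_image)
    then show ?thesis
      using z(1) by (auto simp: S_def)
  qed

  \<comment> \<open>If the window saw no difference, \<open>x\<close> would agree on it with a periodic configuration, and
    \<open>x\<close> would belong to the tower over its orbit representative \<open>z'\<close>.  The \<open>3t\<close> in \<open>N\<close> leaves room for
    the displacement \<open>m < t\<close> between the two.\<close>
  have aperiodic: "\<exists>j. \<bar>j\<bar> \<le> int N \<and> x j \<noteq> sh (int i) x j"
    if "x \<notin> U" "0 < i" "i < t" for x i
  proof (rule ccontr)
    assume "\<not> ?thesis"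
    then have agree: "x j = sh (int i) x j" if "\<bar>j\<bar> \<le> int N" for j
      using that by blast
    have "1 \<le> i"
      using \<open>0 < i\<close> by simp
    from periodic_of_overlap[OF this \<open>i < t\<close> agree]
    obtain z where z: "periodic t z" "\<And>j. \<bar>j\<bar> \<le> int N \<Longrightarrow> x j = z j"
      by blast
    then obtain z' m where z': "z' \<in> reps t" "m < period z'" "z = sh (int m) z'"
      using reps_exist by blast
    have "\<kappa> z' * period z' \<le> n * t"
      using \<kappa>(1) per(3) z'(1) by (intro mult_le_mono) (auto intro: less_imp_le)
    moreover have "m < t"
      using z' per(3) by fastforce
    ultimately have "sh (- int m) x j = z' j"
      if "j \<in> {- 2 * int t..2 * int t + int (\<kappa> z' * period z')}" for j
    proof -
      have "\<bar>j + int m\<bar> \<le> int N"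
        using that \<open>\<kappa> z' * period z' \<le> n * t\<close> \<open>m < t\<close> N by (auto simp del: of_nat_mult)
      from z(2)[OF this] show ?thesis
        using z'(3) by (simp add: sh_apply)
    qed
    then have "sh (- int m) x \<in> P z'"
      by (simp add: P_def shadow_def)
    moreover have "x = sh (int m) (sh (- int m) x)"
      by simp
    ultimately have "x \<in> Tow (P z') (period z')"
      unfolding in_Tow using z'(2) by blast
    then have "x \<in> U"
      using z'(1) by (auto simp: U_def)
    then show False
      using \<open>x \<notin> U\<close> by blast
  qed
  have "\<exists>B h. determined (M - 2 * t) (\<lambda>x. x \<in> B) \<and> determined (M - 2 * t) h \<and>
    (\<forall>x\<in>B. t \<le> h x \<and> h x < 2 * t) \<and>
    (\<forall>x\<in>B. \<forall>i<h x. sh (int i) x \<in> - U \<and> (0 < i \<longrightarrow> sh (int i) x \<notin> B)) \<and>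
    (\<forall>x\<in>- U. (\<exists>y\<in>B. \<exists>i<h y. x = sh (int i) y) \<or>
      (\<exists>k. 0 < k \<and> k < t \<and> sh (int k) x \<notin> - U \<and> sh (int k - 1) x \<in> - U))"
  proof (rule exists_blocks[OF t _ order_refl])
    show "determined N (\<lambda>x. x \<in> - U)"
      using determined_not[OF det_U] by simp
    show "N + 3 * t + 3 * (2 * N + 1) * t + 2 \<le> M - 2 * t"
      using M by linarith
  qed (use aperiodic in simp)
  then obtain B h where det_B: "determined (M - 2 * t) (\<lambda>x. x \<in> B)" "determined (M - 2 * t) h"
    and h: "\<And>x. x \<in> B \<Longrightarrow> t \<le> h x \<and> h x < 2 * t"
    and B: "\<And>x i. x \<in> B \<Longrightarrow> i < h x \<Longrightarrow> sh (int i) x \<notin> U \<and> (0 < i \<longrightarrow> sh (int i) x \<notin> B)"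
    and cover: "\<And>x. x \<notin> U \<Longrightarrow> (\<exists>y\<in>B. \<exists>i<h y. x = sh (int i) y) \<or>
      (\<exists>k. 0 < k \<and> k < t \<and> sh (int k) x \<in> U \<and> sh (int k - 1) x \<notin> U)"
    unfolding Compl_iff not_not by blast

  \<comment> \<open>Splitting the base according to height and pattern makes the projection of each base a
    single point.\<close>
  define cell where "cell j u = {x \<in> B. h x = j \<and> window_proj j x = u}" for j u
  define \<T>\<^sub>1 where "\<T>\<^sub>1 = {(P z, period z) |z. z \<in> reps t \<and> tower_closed \<mu> \<delta> (P z) (period z)}"
  define \<T>\<^sub>2 where "\<T>\<^sub>2 = {(cell j u, j) |j u. j \<in> {t..<2 * t} \<and> u \<in> patterns j \<and> cell j u \<noteq> {}}"
  define e where "e = - (\<Union>(b, j)\<in>\<T>\<^sub>1 \<union> \<T>\<^sub>2. Tow b j)"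
  have "finite \<T>\<^sub>1"
    unfolding \<T>\<^sub>1_def by (rule finite_subset[OF _ finite_imageI[OF finite_reps]]) auto
  moreover have "finite \<T>\<^sub>2"
    unfolding \<T>\<^sub>2_def
    by (rule finite_subset[of _ "(\<lambda>(j, u). (cell j u, j)) ` (SIGMA j:{t..<2 * t}. patterns j)"])
      (auto intro!: finite_imageI finite_SigmaI finite_patterns)
  ultimately have fin: "finite (\<T>\<^sub>1 \<union> \<T>\<^sub>2)"
    by simp
  have det_cell: "determined (M - 2 * t) (\<lambda>x. x \<in> cell j u)" if "j < 2 * t" for j u
    unfolding cell_def mem_Collect_eq using that M
    by (intro determined_conj det_B determined_compose[OF det_B(2)]
        determined_compose[OF determined_window_proj]) simp
  have base: "b \<noteq> {} \<and> 1 \<le> j \<and> j < 2 * t \<and> determined (M - 2 * t) (\<lambda>x. x \<in> b)"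
    if "(b, j) \<in> \<T>\<^sub>1 \<union> \<T>\<^sub>2" for b j
    using that
  proof
    assume "(b, j) \<in> \<T>\<^sub>1"
    then obtain z where z: "z \<in> reps t" "b = P z" "j = period z"
      by (auto simp: \<T>\<^sub>1_def)
    moreover have "determined (M - 2 * t) (\<lambda>x. x \<in> P z)"
      using det_P[OF z(1)] by (rule determined_mono) (use M N in simp)
    ultimately show ?thesis
      using per(2,3)[OF z(1)] shadow_in[of z t] by (auto simp: P_def)
  next
    assume "(b, j) \<in> \<T>\<^sub>2"
    then show ?thesis
      using det_cell t by (auto simp: \<T>\<^sub>2_def)
  qed
  have level: "n_defined M ((shift ^^ i) ` b)" if "(b, j) \<in> \<T>\<^sub>1 \<union> \<T>\<^sub>2" "i < j" for b j i
    unfolding n_defined_iff shift_pow_image mem_Collect_eq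
    using base[OF that(1)] that(2) M by (intro determined_sh[of "M - 2 * t" "\<lambda>x. x \<in> b"]) auto

  have "tower_partition (\<Union>(b, j)\<in>\<T>\<^sub>1 \<union> \<T>\<^sub>2. Tow b j) (\<T>\<^sub>1 \<union> \<T>\<^sub>2)"
  proof (rule tower_partitionI[OF fin])
    fix b j assume "(b, j) \<in> \<T>\<^sub>1 \<union> \<T>\<^sub>2"
    then show "b \<noteq> {} \<and> 1 \<le> j \<and> n_defined (M - 2 * t) b"
      using base by (simp add: n_defined_iff)
  next
    fix b j b' j' x i
    assume bj: "(b, j) \<in> \<T>\<^sub>1 \<union> \<T>\<^sub>2" and bj': "(b', j') \<in> \<T>\<^sub>1 \<union> \<T>\<^sub>2"
      and x: "x \<in> b" "i < j" "sh (int i) x \<in> b'"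
    consider (per) z where "z \<in> reps t" "b = P z" "j = period z"
      | (aper) u where "b = cell j u"
      using bj by (auto simp: \<T>\<^sub>1_def \<T>\<^sub>2_def)
    then show "i = 0 \<and> b = b' \<and> j = j'"
    proof cases
      case per
      then have "sh (int i) x \<in> U"
        using x by (auto simp: U_def in_Tow)
      then have "sh (int i) x \<notin> B"
        using B[of "sh (int i) x" 0] h[of "sh (int i) x"] t by fastforce
      then obtain z' where z': "z' \<in> reps t" "b' = P z'" "j' = period z'"
        using bj' x(3) by (auto simp: \<T>\<^sub>1_def \<T>\<^sub>2_def cell_def)
      then have "i = 0 \<and> z = z'"
        using per x unfolding P_def by (intro shadow_disjoint[of z t z' i x]) auto
      then show ?thesis
        using per z' by simp
    next
      case aper
      then have xB: "x \<in> B" "i < h x" "j = h x" "window_proj j x = u"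
        using x by (auto simp: cell_def)
      then have "sh (int i) x \<notin> U" and i: "sh (int i) x \<in> B \<Longrightarrow> i = 0"
        using B by blast+
      then obtain u' where "b' = cell j' u'"
        using bj' x(3) P_U by (auto simp: \<T>\<^sub>1_def \<T>\<^sub>2_def)
      moreover from this have "i = 0"
        using x(3) i by (simp add: cell_def)
      ultimately show ?thesis
        using x(3) xB aper by (auto simp: cell_def)
    qed
  qed
  then have partition: "tower_partition (UNIV - e) (\<T>\<^sub>1 \<union> \<T>\<^sub>2)"
    by (simp add: e_def Compl_eq_Diff_UNIV[symmetric])

  have "n_defined M (Tow b j)" if "(b, j) \<in> \<T>\<^sub>1 \<union> \<T>\<^sub>2" for b j
    using level[OF that] unfolding Tow_def n_defined_iff UN_iff by (intro determined_bex) auto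
  then have def_e: "n_defined M e"
    unfolding e_def n_defined_iff Compl_iff UN_iff
    by (intro determined_not determined_bex) (auto simp: n_defined_iff)

  have single: "is_singleton (window_proj (max j t) ` b)" if bj: "(b, j) \<in> \<T>\<^sub>1 \<union> \<T>\<^sub>2" for b j
    using bj
  proof
    assume "(b, j) \<in> \<T>\<^sub>1"
    then obtain z where z: "z \<in> reps t" "b = P z" "j < t"
      using per(3) by (auto simp: \<T>\<^sub>1_def)
    have "window_proj t x = window_proj t z" if "x \<in> P z" for x
    proof -
      have "x i = z i" if "i \<in> window t" for i
        using \<open>x \<in> P z\<close> that unfolding P_def shadow_def window_def
        by (auto simp del: of_nat_mult)
      then show ?thesis
        unfolding window_proj_def by (rule restrict_ext)
    qed
    then have "window_proj t ` P z = (\<lambda>x. window_proj t z) ` P z"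
      by (rule image_cong[OF refl])
    also have "\<dots> = {window_proj t z}"
      unfolding P_def using shadow_in by (rule image_constant)
    finally show ?thesis
      using z by (simp add: max_absorb2)
  next
    assume "(b, j) \<in> \<T>\<^sub>2"
    then obtain u where "b = cell j u" "b \<noteq> {}" "t \<le> j"
      by (auto simp: \<T>\<^sub>2_def)
    then have "window_proj (max j t) ` b = {u}"
      by (auto simp: cell_def max_def)
    then show ?thesis
      by simp
  qed

  have S_meas: "{x. sh i x \<in> S} \<in> sets \<mu>" for i
  proof -
    have "n_defined (N + nat \<bar>i\<bar>) {x. sh i x \<in> S}"
      unfolding n_defined_iff mem_Collect_eq by (rule determined_sh[OF det_S]) simp
    then show ?thesis
      using n_defined_borel \<mu>(2) by blast
  qed
  have "e \<subseteq> (\<Union>i\<in>{- int t..int t}. {x. sh i x \<in> S})"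
  proof
    fix x assume "x \<in> e"
    then have x: "x \<notin> Tow b j" if "(b, j) \<in> \<T>\<^sub>1 \<union> \<T>\<^sub>2" for b j
      using that by (auto simp: e_def)
    show "x \<in> (\<Union>i\<in>{- int t..int t}. {x. sh i x \<in> S})"
    proof (cases "x \<in> U")
      \<comment> \<open>Only a tower that is not closed is left uncovered, and its base is contained in \<open>S\<close>.\<close>
      case True
      then obtain z y i where z: "z \<in> reps t" "y \<in> P z" "i < period z" "x = sh (int i) y"
        by (auto simp: U_def in_Tow)
      then have "x \<in> Tow (P z) (period z)"
        by (auto simp: in_Tow)
      then have "\<not> tower_closed \<mu> \<delta> (P z) (period z)"
        using x z(1) by (auto simp: \<T>\<^sub>1_def)
      then have "sh (- int i) x \<in> S"
        using z by (auto simp: S_def entry_def)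
      moreover have "i \<le> t"
        using z(3) per(3)[OF z(1)] by simp
      ultimately show ?thesis
        by (intro UN_I[of "- int i"]) auto
    next
      case False
      have "\<not> (\<exists>y\<in>B. \<exists>i<h y. x = sh (int i) y)"
      proof
        assume "\<exists>y\<in>B. \<exists>i<h y. x = sh (int i) y"
        then obtain y i where y: "y \<in> B" "i < h y" "x = sh (int i) y"
          by blast
        then have "y \<in> cell (h y) (window_proj (h y) y)"
          by (simp add: cell_def)
        moreover from this have "(cell (h y) (window_proj (h y) y), h y) \<in> \<T>\<^sub>2"
          using h[OF y(1)] by (auto simp: \<T>\<^sub>2_def patterns_def window_proj_def)
        ultimately show False
          using x y by (auto simp: in_Tow)
      qed
      then obtain k where k: "0 < k" "k < t" "sh (int k) x \<in> U" "sh (int k - 1) x \<notin> U"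
        using cover[OF False] by blast
      then have "sh (int k) x \<in> S"
        by (intro enter) (simp_all add: algebra_simps)
      then show ?thesis
        using k by (intro UN_I[of "int k"]) auto
    qed
  qed
  then have "measure \<mu> e \<le> measure \<mu> (\<Union>i\<in>{- int t..int t}. {x. sh i x \<in> S})"
    using S_meas by (intro finite_measure_mono) auto
  also have "\<dots> \<le> (\<Sum>i\<in>{- int t..int t}. measure \<mu> {x. sh i x \<in> S})"
    using S_meas by (intro finite_measure_subadditive_finite) auto
  also have "\<dots> \<le> (\<Sum>i\<in>{- int t..int t}. \<upsilon> + \<delta> + t * \<eta>)"
  proof (rule sum_mono)
    fix i assume i: "i \<in> {- int t..int t}"
    have "measure \<mu> {x. sh i x \<in> S} \<le> measure \<mu> S + \<bar>real_of_int i\<bar> * \<eta>"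
      using det_S i M by (intro approx_invariant_sh[OF inv \<mu>, of N]) (auto simp: n_defined_iff)
    also have "\<dots> \<le> measure \<mu> S + t * \<eta>"
      using i \<eta> by (intro add_left_mono mult_right_mono) auto
    also have "measure \<mu> S \<le> \<upsilon> + \<delta>"
      unfolding S_def P_def using \<delta> \<upsilon> by (intro measure_entries[OF \<mu>] \<kappa>(2)) auto
    finally show "measure \<mu> {x. sh i x \<in> S} \<le> \<upsilon> + \<delta> + t * \<eta>"
      by simp
  qed
  finally have "measure \<mu> e \<le> (2 * real t + 1) * (\<upsilon> + \<delta> + t * \<eta>)"
    by (simp add: add.commute)

  moreover have "\<forall>(b, j)\<in>\<T>\<^sub>1 \<union> \<T>\<^sub>2. tower_n_defined M b j"
    using level by (auto simp: tower_n_defined_def)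
  moreover have "\<forall>(b, j)\<in>\<T>\<^sub>1 \<union> \<T>\<^sub>2. (j < t \<and> tower_closed \<mu> \<delta> b j) \<or> (t \<le> j \<and> j < 2 * t)"
    using per(3) by (auto simp: \<T>\<^sub>1_def \<T>\<^sub>2_def)
  moreover have "\<forall>(b, j)\<in>\<T>\<^sub>1 \<union> \<T>\<^sub>2. is_singleton (window_proj (max j t) ` b)"
    using single by blast
  ultimately show ?thesis
    using partition def_e by blast
qed

theorem proposition4p3:
  "\<exists>(C\<^sub>0::nat) (C\<^sub>1::real) (K::real). C\<^sub>0 > 0 \<and> C\<^sub>1 > 0 \<and> K > 0 \<and>
    (\<forall>(t::nat) (\<upsilon>::real) (\<delta>::real) (\<eta>::real) (\<mu>::config measure) (l\<^sub>0::nat) (M\<^sub>0::nat).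
       t \<ge> 1 \<and>
       0 < \<upsilon> \<and> \<upsilon> \<le> 1/2 \<and> 0 < \<delta> \<and> \<delta> \<le> 1/2 \<and> 0 < \<eta> \<and> \<eta> \<le> 1/2 \<and>
       l\<^sub>0 = nat \<lceil>C\<^sub>1 * real t * log 2 (1/\<upsilon>) / \<delta>\<rceil> \<and>
       M\<^sub>0 = C\<^sub>0 * t * (t * l\<^sub>0 + t^3 + t * log_star (real l\<^sub>0 + 2)) \<and>
       prob_space \<mu> \<and> sets \<mu> = sets borel \<and>
       approx_invariant M\<^sub>0 \<eta> \<mu>
       \<longrightarrow>
       (\<exists>(e::config set) (\<T>::(config set \<times> nat) set).
          n_defined M\<^sub>0 e \<and>
          measure \<mu> e \<le> K * real t ^ 6 * (\<upsilon> + \<delta> + \<eta>) \<and>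
          tower_partition (UNIV - e) \<T> \<and>
          (\<forall>(b, j) \<in> \<T>. tower_n_defined M\<^sub>0 b j) \<and>
          (\<forall>(b, j) \<in> \<T>. (j < t \<and> tower_closed \<mu> \<delta> b j) \<or> (t \<le> j \<and> j < 6 * t + 1)) \<and>
          (\<forall>(b, j) \<in> \<T>. is_singleton (window_proj (max j t) ` b))))"
proof (rule exI[of _ 20], rule exI[of _ 2], rule exI[of _ 3], intro conjI allI impI)
  fix t :: nat and \<upsilon> \<delta> \<eta> :: real and \<mu> :: "config measure" and l\<^sub>0 M\<^sub>0 :: nat
  assume "t \<ge> 1 \<and>
    0 < \<upsilon> \<and> \<upsilon> \<le> 1/2 \<and> 0 < \<delta> \<and> \<delta> \<le> 1/2 \<and> 0 < \<eta> \<and> \<eta> \<le> 1/2 \<and>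
    l\<^sub>0 = nat \<lceil>2 * real t * log 2 (1/\<upsilon>) / \<delta>\<rceil> \<and>
    M\<^sub>0 = 20 * t * (t * l\<^sub>0 + t^3 + t * log_star (real l\<^sub>0 + 2)) \<and>
    prob_space \<mu> \<and> sets \<mu> = sets borel \<and> approx_invariant M\<^sub>0 \<eta> \<mu>"
  then have t: "1 \<le> t" and \<upsilon>: "0 < \<upsilon>" "\<upsilon> \<le> 1/2" and \<delta>: "0 < \<delta>" "\<delta> \<le> 1/2" and \<eta>: "0 < \<eta>"
    and l\<^sub>0: "l\<^sub>0 = nat \<lceil>2 * real t * log 2 (1/\<upsilon>) / \<delta>\<rceil>"
    and M\<^sub>0: "M\<^sub>0 = 20 * t * (t * l\<^sub>0 + t^3 + t * log_star (real l\<^sub>0 + 2))"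
    and \<mu>: "prob_space \<mu>" "sets \<mu> = sets borel" and inv: "approx_invariant M\<^sub>0 \<eta> \<mu>"
    by blast+
  \<comment> \<open>Since \<open>q \<ge> 2\<close>, rounding \<open>q\<close> up at most doubles it, and the factor \<open>2\<close> in \<open>l\<^sub>0\<close> gives both
    \<open>n t \<le> l\<^sub>0\<close> and \<open>4 t \<le> l\<^sub>0\<close>; all radii become multiples of \<open>t l\<^sub>0\<close>.\<close>
  define q where "q = log 2 (1/\<upsilon>) / \<delta>"
  have "1 \<le> log 2 (1/\<upsilon>)"
    using \<upsilon> by (simp add: le_log_iff field_simps)
  then have q: "2 \<le> q"
    using \<delta> by (simp add: q_def field_simps)
  define n where "n = nat \<lceil>q\<rceil>"
  have n: "q \<le> real n" "real n \<le> q + 1"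
    using q by (simp_all add: n_def)

  have "(1 - \<delta>) ^ n \<le> exp (- \<delta>) ^ n"
    using \<delta> exp_ge_add_one_self[of "- \<delta>"] by (intro power_mono) auto
  also have "\<dots> = exp (- (\<delta> * real n))"
    by (simp add: exp_of_nat_mult[symmetric] mult.commute)
  also have "\<dots> \<le> exp (- ln (1/\<upsilon>))"
  proof -
    have "ln (1/\<upsilon>) \<le> log 2 (1/\<upsilon>)"
      using \<upsilon> ln_2_less_1 by (simp add: log_def field_simps mult_left_le)
    also have "\<dots> = \<delta> * q"
      using \<delta> by (simp add: q_def)
    also have "\<dots> \<le> \<delta> * real n"
      using n(1) \<delta> by (intro mult_left_mono) auto
    finally show ?thesis by simp
  qed
  also have "\<dots> = \<upsilon>"
    using \<upsilon> by (simp add: exp_minus)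
  finally have power: "(1 - \<delta>) ^ n \<le> \<upsilon>" .

  have "2 * real t * q \<le> real l\<^sub>0"
    unfolding l\<^sub>0 q_def by (simp add: field_simps) linarith
  moreover have "real t * real n \<le> real t * (2 * q)" "real t * 4 \<le> real t * (2 * q)"
    using n(2) q by (intro mult_left_mono; simp)+
  ultimately have "real (n * t) \<le> real l\<^sub>0" "real (4 * t) \<le> real l\<^sub>0"
    by (simp_all add: mult.commute mult.left_commute)
  then have l: "n * t \<le> l\<^sub>0" "4 * t \<le> l\<^sub>0"
    by linarith+
  define N where "N = n * t + 3 * t"
  have "N \<le> 2 * l\<^sub>0" "1 \<le> l\<^sub>0" "l\<^sub>0 \<le> t * l\<^sub>0"
    using l t by (simp_all add: N_def)
  then have "(2 * N + 1) * t \<le> (5 * l\<^sub>0) * t"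
    by (intro mult_le_mono) auto
  moreover have "3 * (2 * N + 1) * t = 3 * ((2 * N + 1) * t)" "(5 * l\<^sub>0) * t = 5 * (t * l\<^sub>0)"
    by (simp_all add: algebra_simps)
  ultimately have "N + 5 * t + 3 * (2 * N + 1) * t + 2 \<le> 20 * (t * l\<^sub>0)"
    using \<open>N \<le> 2 * l\<^sub>0\<close> \<open>1 \<le> l\<^sub>0\<close> \<open>l\<^sub>0 \<le> t * l\<^sub>0\<close> l by linarith
  also have "\<dots> \<le> (20 * t) * (t * l\<^sub>0 + t^3 + t * log_star (real l\<^sub>0 + 2))"
    using t by (intro mult_le_mono) simp_all
  also have "\<dots> = M\<^sub>0"
    by (simp add: M\<^sub>0)
  finally have M: "N + 5 * t + 3 * (2 * N + 1) * t + 2 \<le> M\<^sub>0" .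
  have "\<delta> \<le> 1" "0 \<le> \<upsilon>" "0 \<le> \<eta>"
    using \<upsilon> \<delta> \<eta> by simp_all
  from towers_at_scale[OF t \<delta>(1) this power \<mu> inv N_def M]
  obtain e \<T> where e: "n_defined M\<^sub>0 e" "measure \<mu> e \<le> (2 * real t + 1) * (\<upsilon> + \<delta> + t * \<eta>)"
      "tower_partition (UNIV - e) \<T>" "\<forall>(b, j)\<in>\<T>. tower_n_defined M\<^sub>0 b j"
      "\<forall>(b, j)\<in>\<T>. (j < t \<and> tower_closed \<mu> \<delta> b j) \<or> (t \<le> j \<and> j < 2 * t)"
      "\<forall>(b, j)\<in>\<T>. is_singleton (window_proj (max j t) ` b)"
    by blast
  have "(2 * real t + 1) * (\<upsilon> + \<delta> + t * \<eta>) \<le> (3 * real t) * (real t * (\<upsilon> + \<delta> + \<eta>))"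
  proof (rule mult_mono)
    have "\<upsilon> + \<delta> \<le> real t * (\<upsilon> + \<delta>)"
      using t \<upsilon> \<delta> by (simp add: mult_le_cancel_right1)
    then show "\<upsilon> + \<delta> + t * \<eta> \<le> real t * (\<upsilon> + \<delta> + \<eta>)"
      by (simp add: algebra_simps)
  qed (use t \<upsilon> \<delta> \<eta> in auto)
  also have "\<dots> = 3 * real t ^ 2 * (\<upsilon> + \<delta> + \<eta>)"
    by (simp add: power2_eq_square)
  also have "\<dots> \<le> 3 * real t ^ 6 * (\<upsilon> + \<delta> + \<eta>)"
    using t \<upsilon> \<delta> \<eta> by (intro mult_right_mono mult_left_mono power_increasing) auto
  finally have "measure \<mu> e \<le> 3 * real t ^ 6 * (\<upsilon> + \<delta> + \<eta>)"
    using e(2) by linarith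
  then show "\<exists>e \<T>. n_defined M\<^sub>0 e \<and>
      measure \<mu> e \<le> 3 * real t ^ 6 * (\<upsilon> + \<delta> + \<eta>) \<and>
      tower_partition (UNIV - e) \<T> \<and>
      (\<forall>(b, j) \<in> \<T>. tower_n_defined M\<^sub>0 b j) \<and>
      (\<forall>(b, j) \<in> \<T>. (j < t \<and> tower_closed \<mu> \<delta> b j) \<or> (t \<le> j \<and> j < 6 * t + 1)) \<and>
      (\<forall>(b, j) \<in> \<T>. is_singleton (window_proj (max j t) ` b))"
    using e by (intro exI[of _ e] exI[of _ \<T>]) fastforce
qed simp_all

end
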